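(* Let $(E,\mathcal{P})$ be a random locally convex module over $\mathbb{R}$ with base $(\Omega,\mathcal{F},P)$ such that $\mathcal{P}$ has the countable concatenation property, $x\in E$, and $G$ a nonempty $\mathcal{T}_{c}$-closed $L^{0}$-convex subset of $E$ such that $x\notin G$ and $G$ has the countable concatenation property. Then there exists $f\in E^{*}_{c}$ such that $$f(x)>\vee\{f(y): y\in G\}\ \text{ on } H(\{x\},G)\qquad\text{and}\qquad f(x)>\vee\{f(y): y\in G\}.$$ If $\mathbb{R}$ is replaced by $\mathbb{C}$, the result still holds in the following form: there exists $f\in E^*_c$ such that $$(\mathrm{Re} f)(x)>\vee\{(\mathrm{Re} f)(y): y\in G\}\ \text{ on } H(\{x\},G)\qquad\text{and}\qquad (\mathrm{Re} f)(x)>\vee\{(\mathrm{Re} f)(y): y\in G\}.$$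
   Context: $(\Omega,\mathcal{F},P)$ is a probability space, $K=\mathbb{R}$ or $\mathbb{C}$, $L^{0}(\mathcal{F},K)$ is the algebra of equivalence classes (under a.s. equality) of $K$-valued $\mathcal{F}$-measurable functions, and $L^0(\mathcal F,\bar{\mathbb R})$ the complete lattice of equivalence classes of extended real-valued $\mathcal F$-measurable functions with a.s. pointwise order; $\vee$ denotes supremum in it. $\xi>\eta$ means $\xi\ge\eta$ and $\xi\ne\eta$; "$\xi>\eta$ on $A$" ($A\in\mathcal F$) means that representatives satisfy $\xi^0(\omega)>\eta^0(\omega)$ for almost all $\omega\in A$. $L^0_+=\{\xi\in L^0(\mathcal F,\mathbb R):\xi\ge 0\}$; $L^0_{++}$ is the set of $\xi\in L^0_+$ with $\xi>0$ a.s. on $\Omega$. $\tilde I_A$ is the class of the indicator of $A\in\mathcal F$, and $\tilde I_AG=\{\tilde I_Ay:y\in G\}$. An $L^0$-seminorm on a left $L^{0}(\mathcal{F},K)$-module $E$ is a map $\|\cdot\|:E\to L^0_+$ with $\|\xi x\|=|\xi|\,\|x\|$ and $\|x+y\|\le\|x\|+\|y\|$ for all $\xi\in L^0(\mathcal F,K)$, $x,y\in E$. A random locally convex module over $K$ with base $(\Omega,\mathcal F,P)$ is a pair $(E,\mathcal P)$ of a left $L^0(\mathcal F,K)$-module $E$ and a family $\mathcal P$ of $L^0$-seminorms on $E$ such that $\vee\{\|x\|:\|\cdot\|\in\mathcal P\}=0$ iff $x=\theta$ (null element). For finite $Q\subset\mathcal P$ put $\|x\|_Q=\vee\{\|x\|:\|\cdot\|\in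 Q\}$. $\mathcal T_c$ is the topology on $E$ in which $G\subset E$ is open iff for every $x\in G$ there are a finite $Q\subset\mathcal P$ and $\varepsilon\in L^0_{++}$ with $x+\{y:\|y\|_Q\le\varepsilon\}\subset G$; $L^0(\mathcal F,K)$ carries the $\mathcal T_c$ induced by $|\cdot|$. $E^*_c$ is the set of continuous module homomorphisms from $(E,\mathcal T_c)$ to $(L^0(\mathcal F,K),\mathcal T_c)$. $(\mathrm{Re}f)(x)=\mathrm{Re}(f(x))$. $G\subset E$ is $L^0$-convex if $\xi x+(1-\xi)y\in G$ for all $x,y\in G$ and $\xi\in L^0_+$ with $0\le\xi\le1$. $\mathcal P$ has the countable concatenation property if $\sum_{n\ge1}\tilde I_{A_n}\|\cdot\|_{Q_n}\in\mathcal P$ for every countable partition $\{A_n\}$ of $\Omega$ into members of $\mathcal F$ and every sequence $\{Q_n\}$ of finite subfamilies of $\mathcal P$. A subset $G\subset E$ has the countable concatenation property if for every sequence $\{x_n\}$ in $G$ and every countable partition $\{A_n\}$ of $\Omega$ into members of $\mathcal F$ there is $y\in G$ with $\tilde I_{A_n}y=\tilde I_{A_n}x_n$ for all $n$. The hereditarily disjoint stratification of $\{x\}$ and $G$ is the set (unique a.s.) $H(\{x\},G)=\Omega\setminus\operatorname{ess\,sup}\{A\in\mathcal F:\tilde I_A\{x\}\cap\tilde I_AG\neq\emptyset\}$, where $\operatorname{ess\,sup}$ is the essential supremum of a family of measurable sets. *)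

theory Defs
  imports "HOL-Probability.Probability_Measure" "HOL-Algebra.Module" "HOL-Algebra.Lattice"
begin

section \<open>Equivalence classes of measurable functions\<close>

definition ae_rel :: "'w measure \<Rightarrow> (('w \<Rightarrow> 'b) \<times> ('w \<Rightarrow> 'b::topological_space)) set" where
  "ae_rel M = {(f, g). f \<in> borel_measurable M \<and> g \<in> borel_measurable M \<and> (AE w in M. f w = g w)}"

definition L0 :: "'w measure \<Rightarrow> ('w \<Rightarrow> 'b::topological_space) set set" where
  "L0 M = borel_measurable M // ae_rel M"

definition cls :: "'w measure \<Rightarrow> ('w \<Rightarrow> 'b::topological_space) \<Rightarrow> ('w \<Rightarrow> 'b) set" where
  "cls M f = ae_rel M `` {f}"

text \<open>Operations on classes act on representatives; the union over all representatives is a union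
  of copies of one and the same class.\<close>

definition lift1 :: "'w measure \<Rightarrow> ('a \<Rightarrow> 'b::topological_space) \<Rightarrow> ('w \<Rightarrow> 'a) set \<Rightarrow> ('w \<Rightarrow> 'b) set" where
  "lift1 M h X = (\<Union>f\<in>X. cls M (\<lambda>w. h (f w)))"

definition lift2 ::
  "'w measure \<Rightarrow> ('a \<Rightarrow> 'b \<Rightarrow> 'c::topological_space) \<Rightarrow> ('w \<Rightarrow> 'a) set \<Rightarrow> ('w \<Rightarrow> 'b) set \<Rightarrow> ('w \<Rightarrow> 'c) set" where
  "lift2 M h X Y = (\<Union>f\<in>X. \<Union>g\<in>Y. cls M (\<lambda>w. h (f w) (g w)))"

definition L0_suminf :: "'w measure \<Rightarrow> (nat \<Rightarrow> ('w \<Rightarrow> real) set) \<Rightarrow> ('w \<Rightarrow> real) set" where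
  "L0_suminf M X = (\<Union>f\<in>Pi UNIV X. cls M (\<lambda>w. \<Sum>n. f n w))"

definition L0_indicator :: "'w measure \<Rightarrow> 'w set \<Rightarrow> ('w \<Rightarrow> 'k::real_normed_field) set" where
  "L0_indicator M A = cls M (indicator A)"

text \<open>The record is used both as the ring of scalars and as a module over itself.\<close>

definition L0_alg :: "'w measure \<Rightarrow> (('w \<Rightarrow> 'k::real_normed_field) set, ('w \<Rightarrow> 'k) set) module" where
  "L0_alg M = \<lparr>carrier = L0 M, mult = lift2 M (*), one = cls M (\<lambda>_. 1),
    zero = cls M (\<lambda>_. 0), add = lift2 M (+), smult = lift2 M (*)\<rparr>"

definition L0_ord :: "'w measure \<Rightarrow> ('w \<Rightarrow> 'b::linorder_topology) set gorder" where
  "L0_ord M = \<lparr>carrier = L0 M, eq = (=),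
    le = (\<lambda>X Y. \<exists>f\<in>X. \<exists>g\<in>Y. AE w in M. f w \<le> g w)\<rparr>"

definition gt_on ::
  "'w measure \<Rightarrow> 'w set \<Rightarrow> ('w \<Rightarrow> 'b::linorder_topology) set \<Rightarrow> ('w \<Rightarrow> 'b) set \<Rightarrow> bool" where
  "gt_on M A X Y \<longleftrightarrow> (\<exists>f\<in>X. \<exists>g\<in>Y. AE w in M. w \<in> A \<longrightarrow> f w > g w)"

definition L0_plus :: "'w measure \<Rightarrow> ('w \<Rightarrow> real) set set" where
  "L0_plus M = {X \<in> L0 M. cls M (\<lambda>_. 0) \<sqsubseteq>\<^bsub>L0_ord M\<^esub> X}"

definition L0_pplus :: "'w measure \<Rightarrow> ('w \<Rightarrow> real) set set" where
  "L0_pplus M = {X \<in> L0_plus M. gt_on M (space M) X (cls M (\<lambda>_. 0))}"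

text \<open>The canonical embedding into the complete lattice of classes of extended real-valued
  functions.\<close>

abbreviation L0_ereal :: "'w measure \<Rightarrow> ('w \<Rightarrow> real) set \<Rightarrow> ('w \<Rightarrow> ereal) set" where
  "L0_ereal M \<equiv> lift1 M ereal"

section \<open>Random locally convex modules\<close>

definition L0_seminorm ::
  "'w measure \<Rightarrow> (('w \<Rightarrow> 'k::real_normed_field) set, 'a) module \<Rightarrow> ('a \<Rightarrow> ('w \<Rightarrow> real) set) \<Rightarrow> bool" where
  "L0_seminorm M E p \<longleftrightarrow>
    p \<in> carrier E \<rightarrow>\<^sub>E L0_plus M \<and>
    (\<forall>\<xi>\<in>L0 M. \<forall>x\<in>carrier E. p (\<xi> \<odot>\<^bsub>E\<^esub> x) = lift1 M norm \<xi> \<otimes>\<^bsub>L0_alg M\<^esub> p x) \<and>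
    (\<forall>x\<in>carrier E. \<forall>y\<in>carrier E. p (x \<oplus>\<^bsub>E\<^esub> y) \<sqsubseteq>\<^bsub>L0_ord M\<^esub> p x \<oplus>\<^bsub>L0_alg M\<^esub> p y)"

definition random_lc_module ::
  "'w measure \<Rightarrow> (('w \<Rightarrow> 'k::real_normed_field) set, 'a) module \<Rightarrow> ('a \<Rightarrow> ('w \<Rightarrow> real) set) set \<Rightarrow> bool" where
  "random_lc_module M E P \<longleftrightarrow>
    prob_space M \<and> Module.module (L0_alg M) E \<and> (\<forall>p\<in>P. L0_seminorm M E p) \<and>
    (\<forall>x\<in>carrier E. \<Squnion>\<^bsub>L0_ord M\<^esub> {L0_ereal M (p x) |p. p \<in> P} = cls M (\<lambda>_. 0) \<longleftrightarrow> x = \<zero>\<^bsub>E\<^esub>)"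

definition sup_norm ::
  "'w measure \<Rightarrow> ('a \<Rightarrow> ('w \<Rightarrow> real) set) set \<Rightarrow> 'a \<Rightarrow> ('w \<Rightarrow> real) set" where
  "sup_norm M Q x = \<Squnion>\<^bsub>L0_ord M\<^esub> {p x |p. p \<in> Q}"

text \<open>Finite subfamilies are taken to be nonempty, since the real supremum over the empty family
  does not exist.\<close>

definition fin_subfamilies :: "'p set \<Rightarrow> 'p set set" where
  "fin_subfamilies P = {Q. Q \<subseteq> P \<and> finite Q \<and> Q \<noteq> {}}"

definition Tc ::
  "'w measure \<Rightarrow> (('w \<Rightarrow> 'k::real_normed_field) set, 'a) module \<Rightarrow> ('a \<Rightarrow> ('w \<Rightarrow> real) set) set \<Rightarrow> 'a topology" where
  "Tc M E P = topology (\<lambda>G. G \<subseteq> carrier E \<and>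
    (\<forall>x\<in>G. \<exists>Q\<in>fin_subfamilies P. \<exists>\<epsilon>\<in>L0_pplus M.
      {x \<oplus>\<^bsub>E\<^esub> y |y. y \<in> carrier E \<and> sup_norm M Q y \<sqsubseteq>\<^bsub>L0_ord M\<^esub> \<epsilon>} \<subseteq> G))"

definition Tc_L0 :: "'w measure \<Rightarrow> ('w \<Rightarrow> 'k::real_normed_field) set topology" where
  "Tc_L0 M = Tc M (L0_alg M) {\<lambda>\<xi>\<in>L0 M. lift1 M norm \<xi>}"

definition dual_c ::
  "'w measure \<Rightarrow> (('w \<Rightarrow> 'k::real_normed_field) set, 'a) module \<Rightarrow> ('a \<Rightarrow> ('w \<Rightarrow> real) set) set
    \<Rightarrow> ('a \<Rightarrow> ('w \<Rightarrow> 'k) set) set" where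
  "dual_c M E P = {f \<in> carrier E \<rightarrow>\<^sub>E L0 M.
    (\<forall>x\<in>carrier E. \<forall>y\<in>carrier E. f (x \<oplus>\<^bsub>E\<^esub> y) = f x \<oplus>\<^bsub>L0_alg M\<^esub> f y) \<and>
    (\<forall>\<xi>\<in>L0 M. \<forall>x\<in>carrier E. f (\<xi> \<odot>\<^bsub>E\<^esub> x) = \<xi> \<otimes>\<^bsub>L0_alg M\<^esub> f x) \<and>
    continuous_map (Tc M E P) (Tc_L0 M) f}"

definition L0_convex ::
  "'w measure \<Rightarrow> (('w \<Rightarrow> 'k::real_normed_field) set, 'a) module \<Rightarrow> 'a set \<Rightarrow> bool" where
  "L0_convex M E G \<longleftrightarrow> G \<subseteq> carrier E \<and>
    (\<forall>x\<in>G. \<forall>y\<in>G. \<forall>\<xi>\<in>L0_plus M. \<xi> \<sqsubseteq>\<^bsub>L0_ord M\<^esub> cls M (\<lambda>_. 1) \<longrightarrow>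
      (lift1 M of_real \<xi> \<odot>\<^bsub>E\<^esub> x) \<oplus>\<^bsub>E\<^esub> (lift1 M (\<lambda>t. of_real (1 - t)) \<xi> \<odot>\<^bsub>E\<^esub> y) \<in> G)"

section \<open>Countable concatenation and stratification\<close>

text \<open>Members of a partition may be empty, so finite partitions are included.\<close>

definition countable_partition :: "'w measure \<Rightarrow> (nat \<Rightarrow> 'w set) \<Rightarrow> bool" where
  "countable_partition M A \<longleftrightarrow> range A \<subseteq> sets M \<and> disjoint_family A \<and> (\<Union>n. A n) = space M"

definition concat_seminorms ::
  "'w measure \<Rightarrow> (('w \<Rightarrow> 'k::real_normed_field) set, 'a) module \<Rightarrow> ('a \<Rightarrow> ('w \<Rightarrow> real) set) set \<Rightarrow> bool" where
  "concat_seminorms M E P \<longleftrightarrow>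
    (\<forall>A Q. countable_partition M A \<and> (\<forall>n. Q n \<in> fin_subfamilies P) \<longrightarrow>
      (\<lambda>x\<in>carrier E. L0_suminf M (\<lambda>n. L0_indicator M (A n) \<otimes>\<^bsub>L0_alg M\<^esub> sup_norm M (Q n) x)) \<in> P)"

definition concat_set ::
  "'w measure \<Rightarrow> (('w \<Rightarrow> 'k::real_normed_field) set, 'a) module \<Rightarrow> 'a set \<Rightarrow> bool" where
  "concat_set M E G \<longleftrightarrow>
    (\<forall>A x. countable_partition M A \<and> (\<forall>n. x n \<in> G) \<longrightarrow>
      (\<exists>y\<in>G. \<forall>n. L0_indicator M (A n) \<odot>\<^bsub>E\<^esub> y = L0_indicator M (A n) \<odot>\<^bsub>E\<^esub> x n))"

definition is_ess_sup_sets :: "'w measure \<Rightarrow> 'w set set \<Rightarrow> 'w set \<Rightarrow> bool" where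
  "is_ess_sup_sets M \<A> B \<longleftrightarrow> B \<in> sets M \<and>
    (\<forall>A\<in>\<A>. AE w in M. w \<in> A \<longrightarrow> w \<in> B) \<and>
    (\<forall>C\<in>sets M. (\<forall>A\<in>\<A>. AE w in M. w \<in> A \<longrightarrow> w \<in> C) \<longrightarrow> (AE w in M. w \<in> B \<longrightarrow> w \<in> C))"

text \<open>The essential supremum is determined up to a null set; a version is chosen.\<close>

definition ess_sup_sets :: "'w measure \<Rightarrow> 'w set set \<Rightarrow> 'w set" where
  "ess_sup_sets M \<A> = (SOME B. is_ess_sup_sets M \<A> B)"

definition strat ::
  "'w measure \<Rightarrow> (('w \<Rightarrow> 'k::real_normed_field) set, 'a) module \<Rightarrow> 'a set \<Rightarrow> 'a set \<Rightarrow> 'w set" where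
  "strat M E F G = space M - ess_sup_sets M
    {A \<in> sets M. (\<odot>\<^bsub>E\<^esub>) (L0_indicator M A) ` F \<inter> (\<odot>\<^bsub>E\<^esub>) (L0_indicator M A) ` G \<noteq> {}}"

section \<open>Well-definedness\<close>


lemma equiv_ae_rel: "equiv (borel_measurable M) (ae_rel M)"
proof (rule equivI)
  show "ae_rel M \<subseteq> borel_measurable M \<times> borel_measurable M" by (auto simp: ae_rel_def)
  show "refl_on (borel_measurable M) (ae_rel M)" by (auto simp: ae_rel_def refl_on_def)
  show "sym (ae_rel M)" by (auto simp: ae_rel_def sym_def eq_commute)
  show "trans (ae_rel M)"
    unfolding ae_rel_def trans_def by auto
qed

lemma cls_in_L0 [simp]: "f \<in> borel_measurable M \<Longrightarrow> cls M f \<in> L0 M"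
  by (simp add: cls_def L0_def quotientI)

lemma L0_cases: assumes "X \<in> L0 M" obtains f where "f \<in> borel_measurable M" "X = cls M f"
  using assms by (auto simp: L0_def cls_def elim: quotientE)

lemma mem_cls: "g \<in> cls M f \<longleftrightarrow> f \<in> borel_measurable M \<and> g \<in> borel_measurable M \<and> (AE w in M. f w = g w)"
  by (simp add: cls_def ae_rel_def)

lemma cls_eq_iff:
  "f \<in> borel_measurable M \<Longrightarrow> g \<in> borel_measurable M \<Longrightarrow> cls M f = cls M g \<longleftrightarrow> (AE w in M. f w = g w)"
  using eq_equiv_class_iff[OF equiv_ae_rel, of f M g] by (simp add: cls_def ae_rel_def)

lemma lift1_cls:
  assumes "f \<in> borel_measurable M"
    and "\<And>f. f \<in> borel_measurable M \<Longrightarrow> (\<lambda>w. h (f w)) \<in> borel_measurable M"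
  shows "lift1 M h (cls M f) = cls M (\<lambda>w. h (f w))"
proof -
  have "cls M (\<lambda>w. h (g w)) = cls M (\<lambda>w. h (f w))" if "g \<in> cls M f" for g
    using that assms(2) by (subst cls_eq_iff) (auto simp: mem_cls)
  moreover have "f \<in> cls M f" using assms by (simp add: mem_cls)
  ultimately show ?thesis unfolding lift1_def by blast
qed

lemma lift2_cls:
  assumes "f \<in> borel_measurable M" "g \<in> borel_measurable M"
    and "\<And>f g. f \<in> borel_measurable M \<Longrightarrow> g \<in> borel_measurable M \<Longrightarrow> (\<lambda>w. h (f w) (g w)) \<in> borel_measurable M"
  shows "lift2 M h (cls M f) (cls M g) = cls M (\<lambda>w. h (f w) (g w))"
proof -
  have "cls M (\<lambda>w. h (f' w) (g' w)) = cls M (\<lambda>w. h (f w) (g w))" if "f' \<in> cls M f" "g' \<in> cls M g" for f' g'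
  proof -
    have "AE w in M. f w = f' w" "AE w in M. g w = g' w" using that by (auto simp: mem_cls)
    then have "AE w in M. h (f' w) (g' w) = h (f w) (g w)" by eventually_elim simp
    then show ?thesis using that assms(3) by (subst cls_eq_iff) (auto simp: mem_cls)
  qed
  moreover have "f \<in> cls M f" "g \<in> cls M g" using assms by (simp_all add: mem_cls)
  ultimately show ?thesis unfolding lift2_def by blast
qed

lemma L0_alg_simps:
  fixes f g :: "'w \<Rightarrow> 'k::{real_normed_field, second_countable_topology}"
  assumes "f \<in> borel_measurable M" "g \<in> borel_measurable M"
  shows "cls M f \<oplus>\<^bsub>L0_alg M\<^esub> cls M g = cls M (\<lambda>w. f w + g w)"
    and "cls M f \<otimes>\<^bsub>L0_alg M\<^esub> cls M g = cls M (\<lambda>w. f w * g w)"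
    and "cls M f \<odot>\<^bsub>L0_alg M\<^esub> cls M g = cls M (\<lambda>w. f w * g w)"
  using assms by (simp_all add: L0_alg_def lift2_cls)

lemma cring_L0_alg:
  "cring (L0_alg M :: (('w \<Rightarrow> 'k::{real_normed_field, second_countable_topology}) set, _) module)"
proof -
  let ?R = "L0_alg M :: (('w \<Rightarrow> 'k) set, _) module"
  have car: "carrier ?R = L0 M" and z: "\<zero>\<^bsub>?R\<^esub> = cls M (\<lambda>_. 0)" and o: "\<one>\<^bsub>?R\<^esub> = cls M (\<lambda>_. 1)"
    by (simp_all add: L0_alg_def)
  note s = L0_alg_simps car z o
  have "abelian_group ?R"
  proof (rule abelian_groupI)
    fix x y assume "x \<in> carrier ?R" "y \<in> carrier ?R"
    then obtain f g where "f \<in> borel_measurable M" "x = cls M f" "g \<in> borel_measurable M" "y = cls M g"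
      unfolding car by (elim L0_cases)
    then show "x \<oplus>\<^bsub>?R\<^esub> y \<in> carrier ?R" "x \<oplus>\<^bsub>?R\<^esub> y = y \<oplus>\<^bsub>?R\<^esub> x"
      by (simp_all add: s add.commute)
  next
    fix x y v assume "x \<in> carrier ?R" "y \<in> carrier ?R" "v \<in> carrier ?R"
    then obtain f g h where "f \<in> borel_measurable M" "x = cls M f" "g \<in> borel_measurable M" "y = cls M g"
      "h \<in> borel_measurable M" "v = cls M h"
      unfolding car by (elim L0_cases)
    then show "x \<oplus>\<^bsub>?R\<^esub> y \<oplus>\<^bsub>?R\<^esub> v = x \<oplus>\<^bsub>?R\<^esub> (y \<oplus>\<^bsub>?R\<^esub> v)"
      by (simp add: s add.assoc)
  next
    fix x assume "x \<in> carrier ?R"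
    then obtain f where f: "f \<in> borel_measurable M" "x = cls M f"
      unfolding car by (elim L0_cases)
    then show "\<zero>\<^bsub>?R\<^esub> \<oplus>\<^bsub>?R\<^esub> x = x" by (simp add: s)
    show "\<exists>y\<in>carrier ?R. y \<oplus>\<^bsub>?R\<^esub> x = \<zero>\<^bsub>?R\<^esub>"
      using f by (intro bexI[of _ "cls M (\<lambda>w. - f w)"]) (simp_all add: s)
  qed (simp add: s)
  moreover have "Group.comm_monoid ?R"
  proof (rule comm_monoidI)
    fix x y assume "x \<in> carrier ?R" "y \<in> carrier ?R"
    then obtain f g where "f \<in> borel_measurable M" "x = cls M f" "g \<in> borel_measurable M" "y = cls M g"
      unfolding car by (elim L0_cases)
    then show "x \<otimes>\<^bsub>?R\<^esub> y \<in> carrier ?R" "x \<otimes>\<^bsub>?R\<^esub> y = y \<otimes>\<^bsub>?R\<^esub> x"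
      by (simp_all add: s mult.commute)
  next
    fix x y v assume "x \<in> carrier ?R" "y \<in> carrier ?R" "v \<in> carrier ?R"
    then obtain f g h where "f \<in> borel_measurable M" "x = cls M f" "g \<in> borel_measurable M" "y = cls M g"
      "h \<in> borel_measurable M" "v = cls M h"
      unfolding car by (elim L0_cases)
    then show "x \<otimes>\<^bsub>?R\<^esub> y \<otimes>\<^bsub>?R\<^esub> v = x \<otimes>\<^bsub>?R\<^esub> (y \<otimes>\<^bsub>?R\<^esub> v)"
      by (simp add: s mult.assoc)
  next
    fix x assume "x \<in> carrier ?R"
    then obtain f where "f \<in> borel_measurable M" "x = cls M f"
      unfolding car by (elim L0_cases)
    then show "\<one>\<^bsub>?R\<^esub> \<otimes>\<^bsub>?R\<^esub> x = x" by (simp add: s)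
  qed (simp add: s)
  moreover have "(x \<oplus>\<^bsub>?R\<^esub> y) \<otimes>\<^bsub>?R\<^esub> v = x \<otimes>\<^bsub>?R\<^esub> v \<oplus>\<^bsub>?R\<^esub> y \<otimes>\<^bsub>?R\<^esub> v"
    if xyv: "x \<in> carrier ?R" "y \<in> carrier ?R" "v \<in> carrier ?R" for x y v
  proof -
    obtain f g h where "f \<in> borel_measurable M" "x = cls M f" "g \<in> borel_measurable M" "y = cls M g"
      "h \<in> borel_measurable M" "v = cls M h"
      using xyv unfolding car by (elim L0_cases)
    then show ?thesis by (simp add: s distrib_right)
  qed
  ultimately show ?thesis by (rule cringI)
qed

lemma module_L0_alg:
  "Module.module (L0_alg M) (L0_alg M :: (('w \<Rightarrow> 'k::{real_normed_field, second_countable_topology}) set, _) module)"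
proof -
  interpret cring "L0_alg M :: (('w \<Rightarrow> 'k) set, _) module" by (rule cring_L0_alg)
  have "(\<odot>\<^bsub>L0_alg M :: (('w \<Rightarrow> 'k) set, _) module\<^esub>) = (\<otimes>\<^bsub>L0_alg M\<^esub>)" by (simp add: L0_alg_def)
  then show ?thesis
    by (intro moduleI cring_L0_alg abelian_group_axioms) (simp_all add: l_distr r_distr m_assoc)
qed

lemma le_cls:
  assumes "f \<in> borel_measurable M" "g \<in> borel_measurable M"
  shows "cls M f \<sqsubseteq>\<^bsub>L0_ord M\<^esub> cls M g \<longleftrightarrow> (AE w in M. f w \<le> g w)"
proof
  assume "cls M f \<sqsubseteq>\<^bsub>L0_ord M\<^esub> cls M g"
  then obtain f' g' where "AE w in M. f w = f' w" "AE w in M. g w = g' w" "AE w in M. f' w \<le> g' w"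
    by (auto simp: L0_ord_def mem_cls)
  then show "AE w in M. f w \<le> g w" by eventually_elim simp
next
  assume "AE w in M. f w \<le> g w"
  moreover have "f \<in> cls M f" "g \<in> cls M g" using assms by (simp_all add: mem_cls)
  ultimately show "cls M f \<sqsubseteq>\<^bsub>L0_ord M\<^esub> cls M g" by (auto simp: L0_ord_def)
qed

lemma partial_order_L0_ord: "Order.partial_order (L0_ord M)"
proof
  have c: "carrier (L0_ord M) = L0 M" by (simp add: L0_ord_def)
  show "(.=\<^bsub>L0_ord M\<^esub>) = (=)" by (simp add: L0_ord_def)
  show "x \<sqsubseteq>\<^bsub>L0_ord M\<^esub> x" if x: "x \<in> carrier (L0_ord M)" for x :: "('a \<Rightarrow> 'b) set"
  proof -
    obtain f where "f \<in> borel_measurable M" "x = cls M f" using x unfolding c by (elim L0_cases)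
    then show ?thesis by (simp add: le_cls)
  qed
  show "x .=\<^bsub>L0_ord M\<^esub> y" if le: "x \<sqsubseteq>\<^bsub>L0_ord M\<^esub> y" "y \<sqsubseteq>\<^bsub>L0_ord M\<^esub> x"
    and xy: "x \<in> carrier (L0_ord M)" "y \<in> carrier (L0_ord M)" for x y :: "('a \<Rightarrow> 'b) set"
  proof -
    obtain f g where fg: "f \<in> borel_measurable M" "x = cls M f" "g \<in> borel_measurable M" "y = cls M g" using xy unfolding c by (elim L0_cases)
    with le have "AE w in M. f w \<le> g w" "AE w in M. g w \<le> f w" by (simp_all add: le_cls)
    then have "AE w in M. f w = g w" by eventually_elim simp
    with fg show ?thesis by (simp add: L0_ord_def cls_eq_iff)
  qed
  show "x \<sqsubseteq>\<^bsub>L0_ord M\<^esub> z" if le: "x \<sqsubseteq>\<^bsub>L0_ord M\<^esub> y" "y \<sqsubseteq>\<^bsub>L0_ord M\<^esub> z"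
    and xy: "x \<in> carrier (L0_ord M)" "y \<in> carrier (L0_ord M)" "z \<in> carrier (L0_ord M)" for x y z :: "('a \<Rightarrow> 'b) set"
  proof -
    obtain f g h where fg: "f \<in> borel_measurable M" "x = cls M f" "g \<in> borel_measurable M" "y = cls M g" "h \<in> borel_measurable M" "z = cls M h" using xy unfolding c by (elim L0_cases)
    with le have "AE w in M. f w \<le> g w" "AE w in M. g w \<le> h w" by (simp_all add: le_cls)
    then have "AE w in M. f w \<le> h w" by eventually_elim simp
    with fg show ?thesis by (simp add: le_cls)
  qed
qed (auto simp: L0_ord_def)


lemma carrier_L0_ord [simp]: "carrier (L0_ord M) = L0 M" by (simp add: L0_ord_def)

lemma upper_semilattice_L0_ord:
  "upper_semilattice (L0_ord M :: ('w \<Rightarrow> 'b::{linorder_topology, second_countable_topology}) set gorder)"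
proof -
  interpret Order.partial_order "L0_ord M :: ('w \<Rightarrow> 'b) set gorder" by (rule partial_order_L0_ord)
  show ?thesis
  proof
    fix x y :: "('w \<Rightarrow> 'b) set" assume "x \<in> carrier (L0_ord M)" "y \<in> carrier (L0_ord M)"
    then obtain f g where fg: "f \<in> borel_measurable M" "x = cls M f" "g \<in> borel_measurable M" "y = cls M g"
      unfolding carrier_L0_ord by (elim L0_cases)
    have m: "(\<lambda>w. max (f w) (g w)) \<in> borel_measurable M" using fg by simp
    have "least (L0_ord M) (cls M (\<lambda>w. max (f w) (g w))) (Upper (L0_ord M) {x, y})"
    proof (rule least_UpperI)
      show "z \<sqsubseteq>\<^bsub>L0_ord M\<^esub> cls M (\<lambda>w. max (f w) (g w))" if "z \<in> {x, y}" for z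
        using that fg m by (auto simp: le_cls)
      show "cls M (\<lambda>w. max (f w) (g w)) \<sqsubseteq>\<^bsub>L0_ord M\<^esub> z" if "z \<in> Upper (L0_ord M) {x, y}" for z
      proof -
        have "z \<in> L0 M" using that by (simp add: Upper_def)
        then obtain h where h: "h \<in> borel_measurable M" "z = cls M h" by (elim L0_cases)
        have "x \<sqsubseteq>\<^bsub>L0_ord M\<^esub> z" "y \<sqsubseteq>\<^bsub>L0_ord M\<^esub> z" using that fg by (auto simp: Upper_def)
        then have "AE w in M. f w \<le> h w" "AE w in M. g w \<le> h w" using fg h by (auto simp: le_cls)
        then have "AE w in M. max (f w) (g w) \<le> h w" by eventually_elim simp
        then show ?thesis using h m by (simp add: le_cls)
      qed
    qed (use fg m in auto)
    then show "\<exists>s. least (L0_ord M) s (Upper (L0_ord M) {x, y})" ..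
  qed
qed

lemma sup_norm_least:
  fixes M :: "'w measure"
  assumes "\<forall>p\<in>P. L0_seminorm M E p" "Q \<in> fin_subfamilies P" "x \<in> carrier E"
  shows "least (L0_ord M) (sup_norm M Q x) (Upper (L0_ord M) {p x |p. p \<in> Q})"
proof -
  interpret upper_semilattice "L0_ord M :: ('w \<Rightarrow> real) set gorder" by (rule upper_semilattice_L0_ord)
  have "p x \<in> L0 M" if "p \<in> Q" for p
  proof -
    have "p \<in> carrier E \<rightarrow> L0_plus M" using assms that by (auto simp: fin_subfamilies_def L0_seminorm_def)
    then show ?thesis using assms(3) by (auto simp: L0_plus_def)
  qed
  then show ?thesis unfolding sup_norm_def
    using assms by (intro finite_sup_least) (auto simp: fin_subfamilies_def)
qed

lemma istopology_Tc:
  fixes M :: "'w measure"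
  assumes "\<forall>p\<in>P. L0_seminorm M E p"
  shows "istopology (\<lambda>G. G \<subseteq> carrier E \<and>
    (\<forall>x\<in>G. \<exists>Q\<in>fin_subfamilies P. \<exists>\<epsilon>\<in>L0_pplus M.
      {x \<oplus>\<^bsub>E\<^esub> y |y. y \<in> carrier E \<and> sup_norm M Q y \<sqsubseteq>\<^bsub>L0_ord M\<^esub> \<epsilon>} \<subseteq> G))"
    (is "istopology (\<lambda>G. G \<subseteq> carrier E \<and> (\<forall>x\<in>G. \<exists>Q\<in>_. \<exists>\<epsilon>\<in>_. ?B x Q \<epsilon> \<subseteq> G))")
proof -
  interpret upper_semilattice "L0_ord M :: ('w \<Rightarrow> real) set gorder" by (rule upper_semilattice_L0_ord)
  have ball: "\<exists>Q\<in>fin_subfamilies P. \<exists>\<epsilon>\<in>L0_pplus M. \<forall>x. ?B x Q \<epsilon> \<subseteq> ?B x Q1 e1 \<inter> ?B x Q2 e2"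
    if Q: "Q1 \<in> fin_subfamilies P" "Q2 \<in> fin_subfamilies P" and e: "e1 \<in> L0_pplus M" "e2 \<in> L0_pplus M"
    for Q1 Q2 e1 e2
  proof -
    let ?Q = "Q1 \<union> Q2"
    have Q': "?Q \<in> fin_subfamilies P" using Q by (auto simp: fin_subfamilies_def)
    obtain f g where fg: "f \<in> borel_measurable M" "e1 = cls M f" "g \<in> borel_measurable M" "e2 = cls M g"
      using e unfolding L0_pplus_def L0_plus_def mem_Collect_eq by (elim conjE L0_cases)
    have pos: "AE w in M. w \<in> space M \<longrightarrow> h w > 0" if h: "cls M h \<in> L0_pplus M" for h
    proof -
      obtain h' k where "AE w in M. h w = h' w" "AE w in M. k w = 0" "AE w in M. w \<in> space M \<longrightarrow> k w < h' w"
        using h by (auto simp: L0_pplus_def gt_on_def mem_cls eq_commute[of 0])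
      then show ?thesis by eventually_elim auto
    qed
    define m where "m = (\<lambda>w. min (f w) (g w))"
    have m: "m \<in> borel_measurable M" using fg by (simp add: m_def)
    have "AE w in M. f w > 0" "AE w in M. g w > 0" using pos[of f] pos[of g] e fg AE_space by auto
    then have mpos: "AE w in M. 0 < m w" by eventually_elim (simp add: m_def)
    then have m0: "AE w in M. 0 \<le> m w" by eventually_elim simp
    have "cls M (\<lambda>_. 0) \<sqsubseteq>\<^bsub>L0_ord M\<^esub> cls M m"
      using m m0 by (simp add: le_cls)
    moreover have "gt_on M (space M) (cls M m) (cls M (\<lambda>_. 0))" unfolding gt_on_def
    proof (intro bexI)
      show "AE w in M. w \<in> space M \<longrightarrow> 0 < m w" using mpos by eventually_elim simp
    qed (use m in \<open>simp_all add: mem_cls\<close>)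
    ultimately have mp: "cls M m \<in> L0_pplus M" using m by (simp add: L0_pplus_def L0_plus_def)
    have me: "cls M m \<sqsubseteq>\<^bsub>L0_ord M\<^esub> e1" "cls M m \<sqsubseteq>\<^bsub>L0_ord M\<^esub> e2" using fg m by (auto simp: le_cls) (auto simp: m_def)
    have L: "e1 \<in> L0 M" "e2 \<in> L0 M" "cls M m \<in> L0 M" using fg m by auto
    have mono: "sup_norm M Q' y \<sqsubseteq>\<^bsub>L0_ord M\<^esub> sup_norm M ?Q y \<and> sup_norm M Q' y \<in> L0 M \<and> sup_norm M ?Q y \<in> L0 M"
      if "Q' \<subseteq> ?Q" "Q' \<in> fin_subfamilies P" "y \<in> carrier E" for Q' y
    proof -
      have a: "least (L0_ord M) (sup_norm M Q' y) (Upper (L0_ord M) {p y |p. p \<in> Q'})"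
        and b: "least (L0_ord M) (sup_norm M ?Q y) (Upper (L0_ord M) {p y |p. p \<in> ?Q})"
        by (rule sup_norm_least[OF assms that(2,3)], rule sup_norm_least[OF assms Q' that(3)])
      have le: "\<And>z. z \<in> Upper (L0_ord M) {p y |p. p \<in> Q'} \<Longrightarrow> sup_norm M Q' y \<sqsubseteq>\<^bsub>L0_ord M\<^esub> z"
        using a unfolding least_def by blast
      have up: "sup_norm M ?Q y \<in> Upper (L0_ord M) {p y |p. p \<in> ?Q}"
        using b unfolding least_def by blast
      have up': "sup_norm M Q' y \<in> Upper (L0_ord M) {p y |p. p \<in> Q'}"
        using a unfolding least_def by blast
      have sub: "{p y |p. p \<in> Q'} \<subseteq> {p y |p. p \<in> ?Q}" using that(1) by blast
      have "sup_norm M Q' y \<sqsubseteq>\<^bsub>L0_ord M\<^esub> sup_norm M ?Q y"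
        by (rule le, rule subsetD[OF Upper_antimono[OF sub] up])
      moreover have "sup_norm M ?Q y \<in> L0 M" using subsetD[OF Upper_closed up] by (simp only: carrier_L0_ord)
      moreover have "sup_norm M Q' y \<in> L0 M" using subsetD[OF Upper_closed up'] by (simp only: carrier_L0_ord)
      ultimately show ?thesis by (intro conjI)
    qed
    have "?B x ?Q (cls M m) \<subseteq> ?B x Q1 e1 \<inter> ?B x Q2 e2" for x
    proof -
      have "sup_norm M Q1 y \<sqsubseteq>\<^bsub>L0_ord M\<^esub> e1 \<and> sup_norm M Q2 y \<sqsubseteq>\<^bsub>L0_ord M\<^esub> e2"
        if y: "y \<in> carrier E" "sup_norm M ?Q y \<sqsubseteq>\<^bsub>L0_ord M\<^esub> cls M m" for y
      proof -
        have tr: "sup_norm M Q' y \<sqsubseteq>\<^bsub>L0_ord M\<^esub> e"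
          if *: "Q' \<subseteq> ?Q" "Q' \<in> fin_subfamilies P" "cls M m \<sqsubseteq>\<^bsub>L0_ord M\<^esub> e" "e \<in> L0 M" for Q' e
        proof -
          note m' = mono[OF *(1,2) y(1)]
          have "sup_norm M Q' y \<sqsubseteq>\<^bsub>L0_ord M\<^esub> cls M m"
            by (rule le_trans[of _ "sup_norm M ?Q y"]) (use m' y L in \<open>simp_all only: carrier_L0_ord\<close>)
          then show ?thesis
            by (rule le_trans[OF _ *(3)]) (use m' L *(4) in \<open>simp_all only: carrier_L0_ord\<close>)
        qed
        show ?thesis using tr[OF Un_upper1 Q(1) me(1) L(1)] tr[OF Un_upper2 Q(2) me(2) L(2)] ..
      qed
      then show ?thesis by blast
    qed
    then show ?thesis using Q' mp by (intro bexI allI)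
  qed
  show ?thesis unfolding istopology_def
  proof (intro conjI allI impI)
    fix S T
    assume S: "S \<subseteq> carrier E \<and> (\<forall>x\<in>S. \<exists>Q\<in>fin_subfamilies P. \<exists>\<epsilon>\<in>L0_pplus M. ?B x Q \<epsilon> \<subseteq> S)"
      and T: "T \<subseteq> carrier E \<and> (\<forall>x\<in>T. \<exists>Q\<in>fin_subfamilies P. \<exists>\<epsilon>\<in>L0_pplus M. ?B x Q \<epsilon> \<subseteq> T)"
    show "S \<inter> T \<subseteq> carrier E" using S by blast
    show "\<forall>x\<in>S \<inter> T. \<exists>Q\<in>fin_subfamilies P. \<exists>\<epsilon>\<in>L0_pplus M. ?B x Q \<epsilon> \<subseteq> S \<inter> T"
    proof
      fix x assume x: "x \<in> S \<inter> T"
      obtain Q1 e1 where *: "Q1 \<in> fin_subfamilies P" "e1 \<in> L0_pplus M" "?B x Q1 e1 \<subseteq> S"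
        using bspec[OF conjunct2[OF S] IntD1[OF x]] by (elim bexE)
      obtain Q2 e2 where ***: "Q2 \<in> fin_subfamilies P" "e2 \<in> L0_pplus M" "?B x Q2 e2 \<subseteq> T"
        using bspec[OF conjunct2[OF T] IntD2[OF x]] by (elim bexE)
      obtain Q e where **: "Q \<in> fin_subfamilies P" "e \<in> L0_pplus M" "?B x Q e \<subseteq> ?B x Q1 e1 \<inter> ?B x Q2 e2"
        using ball[OF *(1) ***(1) *(2) ***(2)] by (elim bexE) (erule_tac x = x in allE, rule that)
      have "?B x Q e \<subseteq> S \<inter> T" using **(3) Int_mono[OF *(3) ***(3)] by (rule order_trans)
      then show "\<exists>Q\<in>fin_subfamilies P. \<exists>\<epsilon>\<in>L0_pplus M. ?B x Q \<epsilon> \<subseteq> S \<inter> T" using **(1,2) by (intro bexI)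
    qed
  next
    fix \<K>
    assume K: "\<forall>K\<in>\<K>. K \<subseteq> carrier E \<and> (\<forall>x\<in>K. \<exists>Q\<in>fin_subfamilies P. \<exists>\<epsilon>\<in>L0_pplus M. ?B x Q \<epsilon> \<subseteq> K)"
    show "\<Union>\<K> \<subseteq> carrier E" using K by blast
    show "\<forall>x\<in>\<Union>\<K>. \<exists>Q\<in>fin_subfamilies P. \<exists>\<epsilon>\<in>L0_pplus M. ?B x Q \<epsilon> \<subseteq> \<Union>\<K>"
    proof
      fix x assume "x \<in> \<Union>\<K>"
      then obtain k where k: "k \<in> \<K>" "x \<in> k" by blast
      then obtain Q e where "Q \<in> fin_subfamilies P" "e \<in> L0_pplus M" "?B x Q e \<subseteq> k"
        using bspec[OF conjunct2[OF bspec[OF K k(1)]] k(2)] by (elim bexE)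
      moreover from this(3) have "?B x Q e \<subseteq> \<Union>\<K>" using k(1) by (rule order_trans[OF _ Union_upper])
      ultimately show "\<exists>Q\<in>fin_subfamilies P. \<exists>\<epsilon>\<in>L0_pplus M. ?B x Q \<epsilon> \<subseteq> \<Union>\<K>"
        by (intro bexI)
    qed
  qed
qed

lemma ess_sup_sets_exists:
  assumes "prob_space M" "\<A> \<subseteq> sets M"
  shows "is_ess_sup_sets M \<A> (ess_sup_sets M \<A>)"
proof -
  interpret prob_space M by fact
  define V where "V = {measure M (\<Union>\<B>) |\<B>. countable \<B> \<and> \<B> \<subseteq> \<A>}"
  have ne: "V \<noteq> {}" unfolding V_def by (auto intro: exI[of _ "{}"])
  have bdd: "bdd_above V" unfolding V_def by (auto intro!: bdd_aboveI[of _ 1])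
  have "\<exists>\<B>. countable \<B> \<and> \<B> \<subseteq> \<A> \<and> measure M (\<Union>\<B>) > Sup V - 1 / Suc n" for n
  proof -
    have "Sup V - 1 / Suc n < Sup V" by simp
    then obtain v where "v \<in> V" "v > Sup V - 1 / Suc n" using less_cSup_iff[OF ne bdd] by blast
    then show ?thesis unfolding V_def by blast
  qed
  then obtain \<B> where B: "\<And>n. countable (\<B> n)" "\<And>n. \<B> n \<subseteq> \<A>" "\<And>n. measure M (\<Union>(\<B> n)) > Sup V - 1 / Suc n"
    by metis
  define \<C> where "\<C> = (\<Union>n. \<B> n)"
  define C where "C = \<Union>\<C>"
  have cC: "countable \<C>" "\<C> \<subseteq> \<A>" using B unfolding \<C>_def by auto
  then have Cs: "C \<in> sets M" unfolding C_def using assms(2) by (intro sets.countable_Union) auto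
  have ge: "Sup V \<le> measure M C"
  proof (rule field_le_epsilon)
    fix e :: real assume "e > 0"
    then obtain n where n: "1 / Suc n < e" using nat_approx_posE by blast
    have "measure M (\<Union>(\<B> n)) \<le> measure M C"
      by (rule finite_measure_mono) (auto simp: C_def \<C>_def intro: Cs[unfolded C_def \<C>_def])
    then show "Sup V \<le> measure M C + e" using B(3)[of n] n by linarith
  qed
  have "is_ess_sup_sets M \<A> C" unfolding is_ess_sup_sets_def
  proof (intro conjI ballI impI Cs)
    fix A assume A: "A \<in> \<A>"
    have As: "A \<in> sets M" using A assms by auto
    have "measure M (\<Union>(insert A \<C>)) \<in> V" unfolding V_def using cC A by blast
    then have "measure M (A \<union> C) \<le> Sup V" using bdd by (simp add: cSup_upper C_def)
    moreover have "measure M (A \<union> C) = measure M C + measure M (A - C)"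
      using finite_measure_Union[of C "A - C"] As Cs by (simp add: Un_commute)
    ultimately have "measure M (A - C) = 0" using ge measure_nonneg[of M "A - C"] by linarith
    then have "A - C \<in> null_sets M" using As Cs by (simp add: null_sets_def emeasure_eq_measure)
    then have "AE w in M. w \<notin> A - C" by (rule AE_not_in)
    then show "AE w in M. w \<in> A \<longrightarrow> w \<in> C" by eventually_elim auto
  next
    fix D assume "\<forall>A\<in>\<A>. AE w in M. w \<in> A \<longrightarrow> w \<in> D"
    then have "AE w in M. \<forall>A\<in>\<C>. w \<in> A \<longrightarrow> w \<in> D" using cC by (subst AE_ball_countable) auto
    then show "AE w in M. w \<in> C \<longrightarrow> w \<in> D" by eventually_elim (auto simp: C_def)
  qed
  then show ?thesis unfolding ess_sup_sets_def by (rule someI)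
qed

end

theory Submission
  imports Defs
begin

text \<open>
  The seminorms that separate \<open>x\<close> from \<open>G\<close> on a set of positive measure are glued along a countable
  partition into one \<open>p\<close> and one \<open>d \<ge> 0\<close> with \<open>d \<le> p (x - y)\<close> for all \<open>y \<in> G\<close> such that \<open>{d > 0}\<close> is
  as large as possible. On the complement of \<open>{d > 0}\<close> every seminorm makes \<open>x\<close> arbitrarily close to \<open>G\<close>,
  so by concatenation and closedness \<open>x\<close> agrees there with an element of \<open>G\<close>; hence \<open>d > 0\<close> on the
  stratification, and \<open>d\<close> is not zero because \<open>x \<notin> G\<close>.

  The functional comes from a Mazur-Orlicz argument: the sublinear functional
  \<open>q z = inf {p (z + \<xi> (x - y)) - \<xi> d}\<close>, over \<open>\<xi> \<ge> 0\<close> and \<open>y \<in> G\<close>, dominates a linear \<open>f\<close>, and then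
  \<open>f y + d \<le> f x\<close> on \<open>G\<close> while \<open>\<bar>f\<bar> \<le> p\<close>. The linear minorant is a minimal sublinear one, so no
  functionals on submodules, where \<open>\<xi> x\<close> may lie in the submodule without \<open>x\<close>, have to be extended.
  In the complex case \<open>f z - i f (i z)\<close> is used.
\<close>

section \<open>Representatives and essential infima\<close>

text \<open>Fixing one representative per class turns relations between classes into almost sure
  relations between functions. The choice matters only up to a null set.\<close>

definition L0_rep :: "('w \<Rightarrow> 'b) set \<Rightarrow> 'w \<Rightarrow> 'b" where
  "L0_rep X = (SOME f. f \<in> X)"

lemma
  assumes "X \<in> L0 M"
  shows L0_rep_measurable: "L0_rep X \<in> borel_measurable M" and cls_L0_rep: "cls M (L0_rep X) = X"
proof -
  obtain f where f: "f \<in> borel_measurable M" "X = cls M f"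
    using assms by (rule L0_cases)
  then have "f \<in> X" by (simp add: mem_cls)
  then have "L0_rep X \<in> X" unfolding L0_rep_def by (rule someI[of "\<lambda>f. f \<in> X"])
  then show "L0_rep X \<in> borel_measurable M" "cls M (L0_rep X) = X"
    using f by (auto simp: mem_cls cls_eq_iff eq_commute)
qed

lemma AE_L0_rep_cls:
  assumes "f \<in> borel_measurable M"
  shows "AE w in M. L0_rep (cls M f) w = f w"
proof -
  have L: "cls M f \<in> L0 M" using assms by simp
  show ?thesis
    using cls_L0_rep[OF L] cls_eq_iff[OF L0_rep_measurable[OF L] assms] by simp
qed

lemma AE_all_nat: "(\<And>n::nat. AE w in M. R n w) \<Longrightarrow> AE w in M. \<forall>n. R n w"
  by (simp add: AE_all_countable)

lemma L0_pplus_cls: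
  assumes "e \<in> borel_measurable M"
  shows "cls M e \<in> L0_pplus M \<longleftrightarrow> (AE w in M. 0 < e w)"
proof
  assume "cls M e \<in> L0_pplus M"
  then obtain f g where fg: "AE w in M. e w = f w" "AE w in M. 0 = g w"
    "AE w in M. w \<in> space M \<longrightarrow> g w < f w"
    by (auto simp: L0_pplus_def gt_on_def mem_cls)
  then show "AE w in M. 0 < e w"
    using AE_space by eventually_elim auto
next
  assume pos: "AE w in M. 0 < e w"
  then have "AE w in M. 0 \<le> e w" by eventually_elim simp
  moreover have "AE w in M. w \<in> space M \<longrightarrow> 0 < e w" using pos by eventually_elim simp
  then have "gt_on M (space M) (cls M e) (cls M (\<lambda>_. 0))"
    unfolding gt_on_def using assms
    by (intro bexI[of _ e] bexI[of _ "\<lambda>_. 0"]) (auto simp: mem_cls)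
  ultimately show "cls M e \<in> L0_pplus M"
    using assms by (simp add: L0_pplus_def L0_plus_def le_cls)
qed

lemma L0_plus_cls:
  "e \<in> borel_measurable M \<Longrightarrow> cls M e \<in> L0_plus M \<longleftrightarrow> (AE w in M. 0 \<le> e w)"
  by (simp add: L0_plus_def le_cls)

section \<open>Countable partitions and exhaustion of families of measurable sets\<close>

text \<open>At a point of a cell only one summand can be nonzero, so convergence of the series is no
  issue there.\<close>

lemma suminf_indicator_disjoint:
  fixes g :: "nat \<Rightarrow> 'w \<Rightarrow> real"
  assumes "disjoint_family B" "w \<in> B n"
  shows "(\<Sum>k. indicator (B k) w * g k w) = g n w"
proof -
  have "indicator (B k) w * g k w = (if k = n then g n w else 0)" for k
    using assms by (auto simp: disjoint_family_on_def indicator_def)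
  then show ?thesis using suminf_finite[of "{n}" "\<lambda>k. indicator (B k) w * g k w"] by simp
qed

lemma exists_countable_partition:
  assumes "\<And>n. A n \<in> sets M"
  obtains B where "countable_partition M B" "\<And>n. B n \<inter> (\<Union>n. A n) \<subseteq> A n"
proof -
  \<comment> \<open>The complement of the union is put into the cell with index 0, so that the cells
    cover the space. Therefore a cell is contained in \<open>A n\<close> only after intersection
    with the union.\<close>
  define B where "B n = disjointed A n \<union> (if n = 0 then space M - (\<Union>n. A n) else {})" for n :: nat
  have r: "range (disjointed A) \<subseteq> sets M"
    using assms by (intro sets.range_disjointed_sets) auto
  have U: "(\<Union>n. A n) \<in> sets M" using assms by auto
  have "B n \<in> sets M" for n
    using r U assms[of 0] by (auto simp: B_def)
  moreover have "disjoint_family B"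
    unfolding disjoint_family_on_def
  proof (intro ballI impI)
    fix m n :: nat assume "m \<noteq> n"
    then have "disjointed A m \<inter> disjointed A n = {}"
      using disjoint_family_disjointed[of A] by (auto simp: disjoint_family_on_def)
    moreover have "w \<in> (\<Union>n. A n)" if "w \<in> disjointed A k" for w k
      using that disjointed_subset[of A k] by auto
    ultimately show "B m \<inter> B n = {}"
      using \<open>m \<noteq> n\<close> unfolding B_def by (cases "m = 0"; cases "n = 0") (simp_all, blast+)
  qed
  moreover have "(\<Union>n. B n) = space M"
  proof
    show "(\<Union>n. B n) \<subseteq> space M" using \<open>\<And>n. B n \<in> sets M\<close> sets.sets_into_space by blast
    show "space M \<subseteq> (\<Union>n. B n)"
    proof
      fix w assume w: "w \<in> space M"
      show "w \<in> (\<Union>n. B n)"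
      proof (cases "w \<in> (\<Union>n. A n)")
        case True
        then obtain n where "w \<in> disjointed A n" using UN_disjointed_eq[of A] by blast
        then have "w \<in> B n" by (simp add: B_def)
        then show ?thesis by blast
      next
        case False
        then have "w \<in> B 0" using w by (simp add: B_def)
        then show ?thesis by blast
      qed
    qed
  qed
  ultimately have "countable_partition M B" by (auto simp: countable_partition_def)
  moreover have "B n \<inter> (\<Union>n. A n) \<subseteq> A n" for n
    using disjointed_subset[of A n] by (auto simp: B_def split: if_splits)
  ultimately show thesis by (rule that)
qed

text \<open>Exhaustion: sequences whose unions approach the supremal measure are merged into one
  sequence, which attains it. A member sticking out of its union by positive measure could be added
  and would exceed the supremum. Having members of the family themselves, and not just a covering
  set, is what permits gluing their witnesses later.\<close>

lemma (in prob_space) ess_sup_sets_countable: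
  assumes "\<A> \<subseteq> sets M" "\<A> \<noteq> {}"
  obtains A :: "nat \<Rightarrow> 'a set" where "range A \<subseteq> \<A>" "\<And>B. B \<in> \<A> \<Longrightarrow> AE w in M. w \<in> B \<longrightarrow> w \<in> (\<Union>n. A n)"
proof -
  let ?m = "\<lambda>A :: nat \<Rightarrow> 'a set. emeasure M (\<Union>n. A n)"
  let ?S = "{A. range A \<subseteq> \<A>}"
  have "?m ` ?S \<noteq> {}" using assms(2) by (auto intro!: exI[of _ "\<lambda>_. SOME B. B \<in> \<A>"] some_in_eq[THEN iffD2])
  then obtain f :: "nat \<Rightarrow> ennreal" where f: "range f \<subseteq> ?m ` ?S" "Sup (?m ` ?S) = (SUP i. f i)"
    using ennreal_Sup_countable_SUP[of "?m ` ?S"] by auto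
  have "\<forall>i. \<exists>A. range A \<subseteq> \<A> \<and> f i = ?m A" using f(1) by blast
  then obtain F where F: "\<And>i. range (F i) \<subseteq> \<A>" "\<And>i. f i = ?m (F i)" by metis
  define A where "A k = (case prod_decode k of (i, j) \<Rightarrow> F i j)" for k
  have rA: "range A \<subseteq> \<A>" using F(1) by (fastforce simp: A_def split: prod.split)
  have As: "A n \<in> sets M" for n using rA assms by auto
  have "F i j \<in> range A" for i j
    by (rule range_eqI[of _ _ "prod_encode (i, j)"]) (simp add: A_def)
  then have FA: "(\<Union>j. F i j) \<subseteq> (\<Union>n. A n)" for i by blast
  have "f i \<le> ?m A" for i
    unfolding F(2) using FA As by (intro emeasure_mono) auto
  then have sup: "Sup (?m ` ?S) \<le> ?m A" unfolding f(2) by (rule SUP_least)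
  show thesis
  proof (rule that[OF rA])
    fix B assume B: "B \<in> \<A>"
    then have Bs: "B \<in> sets M" using assms by auto
    let ?A' = "case_nat B A"
    have U: "(\<Union>n. ?A' n) = (\<Union>n. A n) \<union> B"
    proof -
      have "(\<Union>n. ?A' n) = ?A' 0 \<union> (\<Union>n. ?A' (Suc n))"
        using UNIV_nat_eq by (metis UN_insert image_image)
      then show ?thesis by auto
    qed
    have "A n \<in> \<A>" for n using rA by blast
    then have "?A' n \<in> \<A>" for n using B by (cases n) simp_all
    then have "range ?A' \<subseteq> \<A>" by blast
    then have "?m ?A' \<in> ?m ` ?S" by (intro image_eqI[of _ _ ?A']) simp_all
    from order_trans[OF Sup_upper[OF this] sup] have "?m ?A' \<le> ?m A" .
    then have le: "measure M ((\<Union>n. A n) \<union> B) \<le> measure M (\<Union>n. A n)"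
      unfolding U by (simp add: emeasure_eq_measure)
    have UA: "(\<Union>n. A n) \<in> sets M" using As by auto
    have "measure M ((\<Union>n. A n) \<union> B) = measure M (\<Union>n. A n) + measure M (B - (\<Union>n. A n))"
      using finite_measure_Union[of "\<Union>n. A n" "B - (\<Union>n. A n)"] UA Bs by simp
    then have "measure M (B - (\<Union>n. A n)) = 0"
      using le measure_nonneg[of M "B - (\<Union>n. A n)"] by linarith
    then have "B - (\<Union>n. A n) \<in> null_sets M"
      using UA Bs by (simp add: null_sets_def emeasure_eq_measure)
    then have "AE w in M. w \<notin> B - (\<Union>n. A n)" by (rule AE_not_in)
    then show "AE w in M. w \<in> B \<longrightarrow> w \<in> (\<Union>n. A n)" by eventually_elim simp
  qed
qed

section \<open>Essential infima and suprema of families of random variables\<close>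

text \<open>The infimum is recovered from the essential suprema of its rational sublevel sets.\<close>

lemma (in prob_space) ess_inf_ereal:
  fixes S :: "('a \<Rightarrow> ereal) set"
  assumes "S \<subseteq> borel_measurable M"
  obtains g where "g \<in> borel_measurable M" "\<And>s. s \<in> S \<Longrightarrow> AE w in M. g w \<le> s w"
    "\<And>h. h \<in> borel_measurable M \<Longrightarrow> (\<And>s. s \<in> S \<Longrightarrow> AE w in M. h w \<le> s w) \<Longrightarrow> AE w in M. h w \<le> g w"
proof -
  define L where "L s r = {w \<in> space M. s w < ereal (of_rat r)}" for s :: "'a \<Rightarrow> ereal" and r
  define B where "B r = ess_sup_sets M ((\<lambda>s. L s r) ` S)" for r
  have Ls: "L s r \<in> sets M" if "s \<in> borel_measurable M" for s r
    using that by (simp add: L_def)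
  have B: "is_ess_sup_sets M ((\<lambda>s. L s r) ` S) (B r)" for r
    unfolding B_def using assms Ls by (intro ess_sup_sets_exists prob_space_axioms) auto
  then have Bs: "B r \<in> sets M" for r by (simp add: is_ess_sup_sets_def)
  \<comment> \<open>The default \<open>\<infinity>\<close> removes from the infimum those
    \<open>r\<close> for which \<open>w\<close> is outside \<open>B r\<close>.\<close>
  define g where "g w = (INF r. if w \<in> B r then ereal (of_rat r) else \<infinity>)" for w
  show thesis
  proof
    show "g \<in> borel_measurable M"
      unfolding g_def using Bs by (intro borel_measurable_INF) (auto intro!: measurable_If_set)
  next
    fix s assume s: "s \<in> S"
    have "AE w in M. w \<in> L s r \<longrightarrow> w \<in> B r" for r
      using B[of r] s by (simp add: is_ess_sup_sets_def)
    then have "AE w in M. \<forall>r. w \<in> L s r \<longrightarrow> w \<in> B r" by (simp add: AE_all_countable)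
    then show "AE w in M. g w \<le> s w" using AE_space
    proof eventually_elim
      fix w assume w: "\<forall>r. w \<in> L s r \<longrightarrow> w \<in> B r" "w \<in> space M"
      show "g w \<le> s w"
      proof (rule ccontr)
        assume "\<not> g w \<le> s w"
        \<comment> \<open>Both \<open>s w\<close> and \<open>g w\<close> may be infinite, so two
          reals \<open>t'\<close> and \<open>t\<close> are inserted before density of the rationals
          in the reals is applied.\<close>
        then obtain t where t: "s w < ereal t" "ereal t < g w"
          using ereal_dense2[of "s w" "g w"] by (auto simp: not_le)
        obtain t' where t': "s w < ereal t'" "ereal t' < ereal t" using ereal_dense2[OF t(1)] by blast
        then obtain r where r: "t' < of_rat r" "of_rat r < t" using of_rat_dense[of t' t] by auto
        have "s w < ereal (of_rat r)" using t'(1) r(1) by (metis less_ereal.simps(1) less_trans)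
        then have "w \<in> B r" using w by (simp add: L_def)
        then have "g w \<le> ereal (of_rat r)" unfolding g_def by (intro INF_lower2[of r]) auto
        also have "\<dots> < ereal t" using r by simp
        finally show False using t(2) by simp
      qed
    qed
  next
    fix h :: "'a \<Rightarrow> ereal" assume h: "h \<in> borel_measurable M" "\<And>s. s \<in> S \<Longrightarrow> AE w in M. h w \<le> s w"
    \<comment> \<open>Since \<open>h\<close> is almost surely below every \<open>s\<close>, each
      \<open>L s r\<close> lies in \<open>L h r\<close> up to a null set; minimality of the
      essential supremum \<open>B r\<close> transfers this to \<open>B r\<close>.\<close>
    have "AE w in M. w \<in> B r \<longrightarrow> w \<in> L h r" for r
    proof -
      have "AE w in M. w \<in> L s r \<longrightarrow> w \<in> L h r" if "s \<in> S" for s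
        using h(2)[OF that] by eventually_elim (auto simp: L_def)
      then show ?thesis using B[of r] Ls[OF h(1)] by (auto simp: is_ess_sup_sets_def)
    qed
    then have "AE w in M. \<forall>r. w \<in> B r \<longrightarrow> w \<in> L h r" by (simp add: AE_all_countable)
    then show "AE w in M. h w \<le> g w"
      unfolding g_def by eventually_elim (rule INF_greatest, auto simp: L_def)
  qed
qed

text \<open>The lattice supremum is defined by choice, so it can be used only after a least upper
  bound is exhibited: the negative of the essential infimum of the negated representatives.\<close>

lemma (in prob_space) L0_ord_sup_ereal:
  assumes "S \<subseteq> (L0 M :: ('a \<Rightarrow> ereal) set set)"
  shows "least (L0_ord M) (\<Squnion>\<^bsub>L0_ord M\<^esub> S) (Upper (L0_ord M) S)"
proof -
  have "(\<lambda>X w. - L0_rep X w) ` S \<subseteq> borel_measurable M"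
    using assms L0_rep_measurable by fastforce
  then obtain g where g: "g \<in> borel_measurable M"
    "\<And>s. s \<in> (\<lambda>X w. - L0_rep X w) ` S \<Longrightarrow> AE w in M. g w \<le> s w"
    "\<And>h. h \<in> borel_measurable M \<Longrightarrow> (\<And>s. s \<in> (\<lambda>X w. - L0_rep X w) ` S \<Longrightarrow> AE w in M. h w \<le> s w)
      \<Longrightarrow> AE w in M. h w \<le> g w"
    by (rule ess_inf_ereal) blast
  have gm: "(\<lambda>w. - g w) \<in> borel_measurable M" using g(1) by simp
  have "least (L0_ord M) (cls M (\<lambda>w. - g w)) (Upper (L0_ord M) S)"
  proof (rule least_UpperI)
    fix X assume X: "X \<in> S"
    then have XL: "X \<in> L0 M" using assms by auto
    have "AE w in M. L0_rep X w \<le> - g w"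
      using g(2)[OF imageI[OF X]] by eventually_elim (metis ereal_minus_le_minus ereal_uminus_uminus)
    then have "cls M (L0_rep X) \<sqsubseteq>\<^bsub>L0_ord M\<^esub> cls M (\<lambda>w. - g w)"
      using L0_rep_measurable[OF XL] gm by (simp add: le_cls)
    then show "X \<sqsubseteq>\<^bsub>L0_ord M\<^esub> cls M (\<lambda>w. - g w)" by (simp add: cls_L0_rep[OF XL])
  next
    fix Y assume Y: "Y \<in> Upper (L0_ord M) S"
    then have "Y \<in> L0 M" by (simp add: Upper_def)
    then obtain h where h: "h \<in> borel_measurable M" "Y = cls M h" by (rule L0_cases)
    have "AE w in M. - h w \<le> - L0_rep X w" if X: "X \<in> S" for X
    proof -
      have XL: "X \<in> L0 M" using X assms by auto
      have "X \<sqsubseteq>\<^bsub>L0_ord M\<^esub> Y" using Y X assms by (auto simp: Upper_def)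
      then have "cls M (L0_rep X) \<sqsubseteq>\<^bsub>L0_ord M\<^esub> cls M h" by (simp add: cls_L0_rep[OF XL] h)
      then show ?thesis using L0_rep_measurable[OF XL] h by (simp add: le_cls)
    qed
    then have "AE w in M. - h w \<le> g w" using h by (intro g(3)) auto
    then have "AE w in M. - g w \<le> h w"
      by eventually_elim (metis ereal_minus_le_minus ereal_uminus_uminus)
    then show "cls M (\<lambda>w. - g w) \<sqsubseteq>\<^bsub>L0_ord M\<^esub> Y" using h gm by (simp add: le_cls)
  qed (use assms gm in auto)
  then show ?thesis unfolding Lattice.sup_def by (rule someI)
qed

text \<open>A member of \<open>S\<close> bounds the extended real infimum from above and
  \<open>b\<close> bounds it from below, so it is finite almost surely and
  \<open>real_of_ereal\<close> alters it on a null set only.\<close>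

lemma (in prob_space) ess_inf_real:
  fixes S :: "('a \<Rightarrow> real) set"
  assumes "S \<subseteq> borel_measurable M" "S \<noteq> {}" "b \<in> borel_measurable M"
    "\<And>s. s \<in> S \<Longrightarrow> AE w in M. b w \<le> s w"
  obtains g where "g \<in> borel_measurable M" "\<And>s. s \<in> S \<Longrightarrow> AE w in M. g w \<le> s w"
    "\<And>h. h \<in> borel_measurable M \<Longrightarrow> (\<And>s. s \<in> S \<Longrightarrow> AE w in M. h w \<le> s w) \<Longrightarrow> AE w in M. h w \<le> g w"
proof -
  let ?e = "\<lambda>s w. ereal (s w)"
  have "?e ` S \<subseteq> borel_measurable M" using assms by auto
  then obtain g where g: "g \<in> borel_measurable M"
    "\<And>s. s \<in> ?e ` S \<Longrightarrow> AE w in M. g w \<le> s w"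
    "\<And>h. h \<in> borel_measurable M \<Longrightarrow> (\<And>s. s \<in> ?e ` S \<Longrightarrow> AE w in M. h w \<le> s w)
      \<Longrightarrow> AE w in M. h w \<le> g w"
    by (rule ess_inf_ereal) blast
  obtain s0 where s0: "s0 \<in> S" using assms by auto
  have "AE w in M. ereal (b w) \<le> g w" using assms by (intro g(3)) auto
  with g(2)[OF imageI[OF s0]] have fin: "AE w in M. g w = ereal (real_of_ereal (g w))"
    by eventually_elim (auto simp: ereal_real)
  show thesis
  proof
    show "(\<lambda>w. real_of_ereal (g w)) \<in> borel_measurable M" using g by simp
    show "AE w in M. real_of_ereal (g w) \<le> s w" if "s \<in> S" for s
      using g(2)[OF imageI[OF that]] fin by eventually_elim (metis ereal_less_eq(3))
    show "AE w in M. h w \<le> real_of_ereal (g w)"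
      if "h \<in> borel_measurable M" "\<And>s. s \<in> S \<Longrightarrow> AE w in M. h w \<le> s w" for h
    proof -
      have "AE w in M. ereal (h w) \<le> g w" using that by (intro g(3)) auto
      with fin show ?thesis by eventually_elim (metis ereal_less_eq(3))
    qed
  qed
qed

section \<open>Sublinear functionals on modules over the algebra of random variables\<close>

locale L0_module = prob_space M + Module.module "L0_alg M" E
  for M :: "'w measure"
    and E :: "(('w \<Rightarrow> 'k::{real_normed_field, second_countable_topology}) set, 'a) module"
begin

section \<open>Multiplication of vectors by real random variables\<close>

text \<open>Real multipliers are embedded into the scalars by \<open>of_real\<close>, so that one
  theory of sublinear functionals serves both the real and the complex case.\<close>

definition rsc :: "('w \<Rightarrow> real) \<Rightarrow> 'a \<Rightarrow> 'a" where
  "rsc \<xi> z = cls M (\<lambda>w. of_real (\<xi> w)) \<odot>\<^bsub>E\<^esub> z"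

lemma carrier_L0_alg [simp]: "carrier (L0_alg M) = (L0 M :: ('w \<Rightarrow> 'k) set set)"
  and one_L0_alg: "\<one>\<^bsub>L0_alg M\<^esub> = (cls M (\<lambda>_. 1) :: ('w \<Rightarrow> 'k) set)"
  and zero_L0_alg: "\<zero>\<^bsub>L0_alg M\<^esub> = (cls M (\<lambda>_. 0) :: ('w \<Rightarrow> 'k) set)"
  by (simp_all add: L0_alg_def)

lemma of_real_measurable [measurable]:
  "\<xi> \<in> borel_measurable M \<Longrightarrow> (\<lambda>w. of_real (\<xi> w) :: 'k) \<in> borel_measurable M"
  by (rule measurable_compose[of \<xi> M borel]) (auto intro!: borel_measurable_continuous_onI continuous_intros)

lemma rsc_closed [simp]: "\<xi> \<in> borel_measurable M \<Longrightarrow> z \<in> carrier E \<Longrightarrow> rsc \<xi> z \<in> carrier E"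
  unfolding rsc_def by (intro smult_closed) simp_all

lemma rsc_add_left:
  assumes "\<xi> \<in> borel_measurable M" "\<eta> \<in> borel_measurable M" "z \<in> carrier E"
  shows "rsc (\<lambda>w. \<xi> w + \<eta> w) z = rsc \<xi> z \<oplus>\<^bsub>E\<^esub> rsc \<eta> z"
  using smult_l_distr[of "cls M (\<lambda>w. of_real (\<xi> w))" "cls M (\<lambda>w. of_real (\<eta> w))" z] assms
  by (simp add: rsc_def L0_alg_simps)

lemma rsc_add_right:
  assumes "\<xi> \<in> borel_measurable M" "y \<in> carrier E" "z \<in> carrier E"
  shows "rsc \<xi> (y \<oplus>\<^bsub>E\<^esub> z) = rsc \<xi> y \<oplus>\<^bsub>E\<^esub> rsc \<xi> z"
  using assms by (simp add: rsc_def smult_r_distr)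

lemma rsc_rsc:
  assumes "\<xi> \<in> borel_measurable M" "\<eta> \<in> borel_measurable M" "z \<in> carrier E"
  shows "rsc \<xi> (rsc \<eta> z) = rsc (\<lambda>w. \<xi> w * \<eta> w) z"
  using smult_assoc1[of "cls M (\<lambda>w. of_real (\<xi> w))" "cls M (\<lambda>w. of_real (\<eta> w))" z] assms
  by (simp add: rsc_def L0_alg_simps)

lemma rsc_cong_AE:
  assumes "\<xi> \<in> borel_measurable M" "\<eta> \<in> borel_measurable M" "AE w in M. \<xi> w = \<eta> w"
  shows "rsc \<xi> z = rsc \<eta> z"
proof -
  have "AE w in M. (of_real (\<xi> w) :: 'k) = of_real (\<eta> w)"
    using assms(3) by eventually_elim simp
  then have "(cls M (\<lambda>w. of_real (\<xi> w)) :: ('w \<Rightarrow> 'k) set) = cls M (\<lambda>w. of_real (\<eta> w))"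
    using assms by (simp add: cls_eq_iff)
  then show ?thesis by (simp add: rsc_def)
qed

lemma rsc_one [simp]: "z \<in> carrier E \<Longrightarrow> rsc (\<lambda>_. 1) z = z"
  using smult_one[of z] by (simp add: rsc_def one_L0_alg)

lemma rsc_zero [simp]: "z \<in> carrier E \<Longrightarrow> rsc (\<lambda>_. 0) z = \<zero>\<^bsub>E\<^esub>"
  using smult_l_null[of z] by (simp add: rsc_def zero_L0_alg)

lemma rsc_uminus:
  assumes "\<xi> \<in> borel_measurable M" "z \<in> carrier E"
  shows "rsc (\<lambda>w. - \<xi> w) z = \<ominus>\<^bsub>E\<^esub> rsc \<xi> z"
proof -
  have "rsc (\<lambda>w. - \<xi> w) z \<oplus>\<^bsub>E\<^esub> rsc \<xi> z = \<zero>\<^bsub>E\<^esub>"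
    using rsc_add_left[of "\<lambda>w. - \<xi> w" \<xi> z] assms by simp
  then show ?thesis using assms by (intro M.minus_equality[symmetric]) auto
qed

lemma rsc_minus_right:
  assumes "\<xi> \<in> borel_measurable M" "z \<in> carrier E"
  shows "rsc \<xi> (\<ominus>\<^bsub>E\<^esub> z) = \<ominus>\<^bsub>E\<^esub> rsc \<xi> z"
  unfolding rsc_def using assms by (intro smult_r_minus) auto

section \<open>Sublinear functionals with values in random variables\<close>

text \<open>Functionals take values in representatives and are compared almost everywhere. One inequality
  suffices for homogeneity: see \<open>sublin_homogeneous\<close>.\<close>

definition sublin :: "('a \<Rightarrow> 'w \<Rightarrow> real) \<Rightarrow> bool" where
  "sublin q \<longleftrightarrow> (\<forall>z\<in>carrier E. q z \<in> borel_measurable M) \<and>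
    (\<forall>y\<in>carrier E. \<forall>z\<in>carrier E. AE w in M. q (y \<oplus>\<^bsub>E\<^esub> z) w \<le> q y w + q z w) \<and>
    (\<forall>\<xi>\<in>borel_measurable M. (\<forall>w. 0 \<le> \<xi> w) \<longrightarrow>
      (\<forall>z\<in>carrier E. AE w in M. q (rsc \<xi> z) w \<le> \<xi> w * q z w))"

definition le_fun :: "('a \<Rightarrow> 'w \<Rightarrow> real) \<Rightarrow> ('a \<Rightarrow> 'w \<Rightarrow> real) \<Rightarrow> bool" where
  "le_fun q r \<longleftrightarrow> (\<forall>z\<in>carrier E. AE w in M. q z w \<le> r z w)"

lemma le_funD: "le_fun q r \<Longrightarrow> z \<in> carrier E \<Longrightarrow> AE w in M. q z w \<le> r z w"
  by (simp add: le_fun_def)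

lemma le_fun_trans:
  assumes "le_fun q r" "le_fun r s"
  shows "le_fun q s"
  unfolding le_fun_def
proof
  fix z assume z: "z \<in> carrier E"
  show "AE w in M. q z w \<le> s z w"
    using le_funD[OF assms(1) z] le_funD[OF assms(2) z] by eventually_elim simp
qed

lemma sublinD:
  assumes "sublin q"
  shows "z \<in> carrier E \<Longrightarrow> q z \<in> borel_measurable M"
    and "y \<in> carrier E \<Longrightarrow> z \<in> carrier E \<Longrightarrow> AE w in M. q (y \<oplus>\<^bsub>E\<^esub> z) w \<le> q y w + q z w"
    and "\<xi> \<in> borel_measurable M \<Longrightarrow> (\<And>w. 0 \<le> \<xi> w) \<Longrightarrow> z \<in> carrier E
      \<Longrightarrow> AE w in M. q (rsc \<xi> z) w \<le> \<xi> w * q z w"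
  using assms by (auto simp: sublin_def)

lemma sublin_zero:
  assumes "sublin q"
  shows "AE w in M. q \<zero>\<^bsub>E\<^esub> w = 0"
proof -
  have "AE w in M. q \<zero>\<^bsub>E\<^esub> w \<le> q \<zero>\<^bsub>E\<^esub> w + q \<zero>\<^bsub>E\<^esub> w"
    using sublinD(2)[OF assms, of "\<zero>\<^bsub>E\<^esub>" "\<zero>\<^bsub>E\<^esub>"] by simp
  moreover have "AE w in M. q \<zero>\<^bsub>E\<^esub> w \<le> 0"
    using sublinD(3)[OF assms, of "\<lambda>_. 0" "\<zero>\<^bsub>E\<^esub>"] by simp
  ultimately show ?thesis by eventually_elim simp
qed

lemma sublin_uminus_ge:
  assumes "sublin q" "z \<in> carrier E"
  shows "AE w in M. - q (\<ominus>\<^bsub>E\<^esub> z) w \<le> q z w"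
proof -
  have "AE w in M. q \<zero>\<^bsub>E\<^esub> w \<le> q z w + q (\<ominus>\<^bsub>E\<^esub> z) w"
    using sublinD(2)[OF assms(1), of z "\<ominus>\<^bsub>E\<^esub> z"] assms(2) by (simp add: M.r_neg)
  with sublin_zero[OF assms(1)] show ?thesis by eventually_elim simp
qed

text \<open>The reverse inequality is the assumed one for the multiplier
  \<open>inverse (\<xi> w)\<close>. As \<open>\<xi>\<close> may vanish on a set of positive measure,
  \<open>z\<close> is first split by the indicators \<open>?I\<close> of the nonvanishing set and
  \<open>?J\<close> of its complement; on the latter both sides are zero.\<close>

lemma sublin_homogeneous:
  assumes q: "sublin q" and \<xi>: "\<xi> \<in> borel_measurable M" "\<And>w. 0 \<le> \<xi> w" and z: "z \<in> carrier E"
  shows "AE w in M. q (rsc \<xi> z) w = \<xi> w * q z w"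
proof -
  let ?I = "\<lambda>w. if \<xi> w = 0 then 0 else 1 :: real" and ?J = "\<lambda>w. if \<xi> w = 0 then 1 else 0 :: real"
  have m [measurable]: "?I \<in> borel_measurable M" "?J \<in> borel_measurable M" "(\<lambda>w. inverse (\<xi> w)) \<in> borel_measurable M"
    using \<xi>(1) by measurable
  \<comment> \<open>The convention \<open>inverse 0 = 0\<close> makes the second identity hold also
    where \<open>\<xi>\<close> vanishes.\<close>
  have "(\<lambda>w. ?I w + ?J w) = (\<lambda>_. 1)" "(\<lambda>w. inverse (\<xi> w) * \<xi> w) = ?I" "(\<lambda>w. ?J w * \<xi> w) = (\<lambda>_. 0)"
    by (auto simp: fun_eq_iff)
  then have eq: "rsc ?I z \<oplus>\<^bsub>E\<^esub> rsc ?J z = z" "rsc (\<lambda>w. inverse (\<xi> w)) (rsc \<xi> z) = rsc ?I z"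
    "rsc ?J (rsc \<xi> z) = \<zero>\<^bsub>E\<^esub>"
    using rsc_add_left[OF m(1,2) z] rsc_rsc[OF m(3) \<xi>(1) z] rsc_rsc[OF m(2) \<xi>(1) z] z by simp_all
  note h = sublinD(3)[OF q]
  have "AE w in M. q z w \<le> q (rsc ?I z) w + q (rsc ?J z) w"
    using sublinD(2)[OF q, of "rsc ?I z" "rsc ?J z"] z m eq(1) by simp
  moreover have "AE w in M. q (rsc ?I z) w \<le> inverse (\<xi> w) * q (rsc \<xi> z) w"
    using h[OF m(3) _ rsc_closed[OF \<xi>(1) z]] \<xi>(2) eq(2) by simp
  moreover have "AE w in M. q (rsc ?J z) w \<le> ?J w * q z w" using h[OF m(2) _ z] by simp
  moreover have "AE w in M. q \<zero>\<^bsub>E\<^esub> w \<le> ?J w * q (rsc \<xi> z) w"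
    using h[OF m(2) _ rsc_closed[OF \<xi>(1) z]] eq(3) by simp
  moreover have "AE w in M. q (rsc \<xi> z) w \<le> \<xi> w * q z w" using h[OF \<xi> z] by simp
  moreover note sublin_zero[OF q]
  ultimately show ?thesis
  proof eventually_elim
    case (elim w)
    show ?case
    proof (cases "\<xi> w = 0")
      case True
      then show ?thesis using elim by simp
    next
      case False
      then have "0 < \<xi> w" using \<xi>(2)[of w] by simp
      moreover have "q z w \<le> inverse (\<xi> w) * q (rsc \<xi> z) w" using elim False by simp
      ultimately have "\<xi> w * q z w \<le> q (rsc \<xi> z) w" by (simp add: field_simps)
      then show ?thesis using elim by simp
    qed
  qed
qed

section \<open>Sublinear functionals as essential infima, and linear minorants\<close>

text \<open>The functional is an essential infimum, formed separately for each \<open>z\<close>; the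
  lower bound \<open>b\<close> keeps it real-valued. The conditions \<open>add\<close> and
  \<open>hom\<close> are stated for the family as a whole, so that they cover both the members
  attached to a cone and the members of a chain.\<close>

lemma sublin_ess_inf:
  assumes T: "T \<noteq> {}"
    and meas: "\<And>t z. t \<in> T \<Longrightarrow> z \<in> carrier E \<Longrightarrow> t z \<in> borel_measurable M"
    and b: "\<And>z. z \<in> carrier E \<Longrightarrow> b z \<in> borel_measurable M"
    and ge: "\<And>t z. t \<in> T \<Longrightarrow> z \<in> carrier E \<Longrightarrow> AE w in M. b z w \<le> t z w"
    and add: "\<And>t t' y z. t \<in> T \<Longrightarrow> t' \<in> T \<Longrightarrow> y \<in> carrier E \<Longrightarrow> z \<in> carrier E \<Longrightarrow>
      \<exists>u\<in>T. AE w in M. u (y \<oplus>\<^bsub>E\<^esub> z) w \<le> t y w + t' z w"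
    and hom: "\<And>t \<xi> z. t \<in> T \<Longrightarrow> \<xi> \<in> borel_measurable M \<Longrightarrow> (\<And>w. 0 \<le> \<xi> w) \<Longrightarrow> z \<in> carrier E \<Longrightarrow>
      \<exists>u\<in>T. AE w in M. u (rsc \<xi> z) w \<le> \<xi> w * t z w"
  obtains r where "sublin r" "\<And>t. t \<in> T \<Longrightarrow> le_fun r t"
proof -
  let ?inf = "\<lambda>z g. g \<in> borel_measurable M \<and> (\<forall>t\<in>T. AE w in M. g w \<le> t z w) \<and>
    (\<forall>h\<in>borel_measurable M. (\<forall>t\<in>T. AE w in M. h w \<le> t z w) \<longrightarrow> (AE w in M. h w \<le> g w))"
  have "\<forall>z\<in>carrier E. \<exists>g. ?inf z g"
  proof
    fix z assume z: "z \<in> carrier E"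
    have "(\<lambda>t. t z) ` T \<subseteq> borel_measurable M" "(\<lambda>t. t z) ` T \<noteq> {}" using meas T z by auto
    then obtain g where "g \<in> borel_measurable M"
      "\<And>s. s \<in> (\<lambda>t. t z) ` T \<Longrightarrow> AE w in M. g w \<le> s w"
      "\<And>h. h \<in> borel_measurable M \<Longrightarrow> (\<And>s. s \<in> (\<lambda>t. t z) ` T \<Longrightarrow> AE w in M. h w \<le> s w)
        \<Longrightarrow> AE w in M. h w \<le> g w"
      by (rule ess_inf_real[OF _ _ b[OF z]]) (use ge z in auto)
    then show "\<exists>g. ?inf z g"
      by (intro exI[of _ g]) auto
  qed
  from bchoice[OF this] obtain r where R: "\<forall>z\<in>carrier E. ?inf z (r z)" ..
  have r: "\<And>z. z \<in> carrier E \<Longrightarrow> r z \<in> borel_measurable M"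
    "\<And>z t. z \<in> carrier E \<Longrightarrow> t \<in> T \<Longrightarrow> AE w in M. r z w \<le> t z w"
    "\<And>z h. z \<in> carrier E \<Longrightarrow> h \<in> borel_measurable M \<Longrightarrow> (\<And>t. t \<in> T \<Longrightarrow> AE w in M. h w \<le> t z w)
      \<Longrightarrow> AE w in M. h w \<le> r z w"
    by (simp_all add: R)
  have "sublin r" unfolding sublin_def
  proof (intro conjI ballI impI)
    fix y z assume yz: "y \<in> carrier E" "z \<in> carrier E"
    note [measurable] = r(1)[OF yz(1)] r(1)[OF yz(2)] r(1)[OF M.a_closed[OF yz]]
    \<comment> \<open>The two infima are taken in turn: for fixed \<open>t'\<close> the left side is
      a lower bound of all \<open>t y\<close>, hence below \<open>r y\<close>; then the same is done
      with \<open>t'\<close> varying.\<close>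
    have *: "AE w in M. r (y \<oplus>\<^bsub>E\<^esub> z) w - t' z w \<le> r y w" if t': "t' \<in> T" for t'
    proof (rule r(3)[OF yz(1)])
      show "(\<lambda>w. r (y \<oplus>\<^bsub>E\<^esub> z) w - t' z w) \<in> borel_measurable M"
        using meas[OF t' yz(2)] by simp
      fix t assume "t \<in> T"
      then obtain u where u: "u \<in> T" "AE w in M. u (y \<oplus>\<^bsub>E\<^esub> z) w \<le> t y w + t' z w"
        using add t' yz by blast
      show "AE w in M. r (y \<oplus>\<^bsub>E\<^esub> z) w - t' z w \<le> t y w"
        using r(2)[OF M.a_closed[OF yz] u(1)] u(2) by eventually_elim simp
    qed
    have "AE w in M. r (y \<oplus>\<^bsub>E\<^esub> z) w - r y w \<le> r z w"
    proof (rule r(3)[OF yz(2)])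
      fix t assume "t \<in> T"
      from *[OF this] show "AE w in M. r (y \<oplus>\<^bsub>E\<^esub> z) w - r y w \<le> t z w"
        by eventually_elim simp
    qed simp
    then show "AE w in M. r (y \<oplus>\<^bsub>E\<^esub> z) w \<le> r y w + r z w"
      by eventually_elim simp
  next
    fix \<xi> :: "'w \<Rightarrow> real" and z assume \<xi>: "\<xi> \<in> borel_measurable M" "\<forall>w. 0 \<le> \<xi> w" and z: "z \<in> carrier E"
    have \<xi>z: "rsc \<xi> z \<in> carrier E" using \<xi> z by simp
    note [measurable] = \<xi>(1) r(1)[OF z] r(1)[OF \<xi>z]
    have le: "AE w in M. r (rsc \<xi> z) w \<le> \<xi> w * t z w" if t: "t \<in> T" for t
    proof -
      obtain u where u: "u \<in> T" "AE w in M. u (rsc \<xi> z) w \<le> \<xi> w * t z w"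
        using hom[OF t \<xi>(1) _ z] \<xi>(2) by blast
      show ?thesis using r(2)[OF \<xi>z u(1)] u(2) by eventually_elim simp
    qed
    \<comment> \<open>Division by \<open>\<xi>\<close> turns the bound into a lower bound of the
      family at \<open>z\<close>. Where \<open>\<xi>\<close> vanishes, \<open>r z\<close> is
      substituted because it is such a lower bound anyway.\<close>
    have "AE w in M. (if \<xi> w = 0 then r z w else r (rsc \<xi> z) w / \<xi> w) \<le> r z w"
    proof (rule r(3)[OF z])
      show "AE w in M. (if \<xi> w = 0 then r z w else r (rsc \<xi> z) w / \<xi> w) \<le> t z w" if "t \<in> T" for t
        using le[OF that] r(2)[OF z that]
      proof eventually_elim
        case (elim w)
        then show ?case using \<xi>(2)[rule_format, of w] by (simp add: field_simps)
      qed
    qed measurable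
    \<comment> \<open>Where \<open>\<xi>\<close> vanishes the previous inequality is empty; there a
      single member \<open>t\<close> gives \<open>r (rsc \<xi> z) w \<le> 0\<close>.\<close>
    moreover obtain t where "t \<in> T" using T by blast
    then have "AE w in M. r (rsc \<xi> z) w \<le> \<xi> w * t z w" by (rule le)
    ultimately show "AE w in M. r (rsc \<xi> z) w \<le> \<xi> w * r z w"
    proof eventually_elim
      case (elim w)
      then show ?case using \<xi>(2)[rule_format, of w] by (simp add: field_simps split: if_splits)
    qed
  qed (use r(1) in auto)
  then show thesis using r(2) by (intro that[of r]) (auto simp: le_fun_def)
qed

text \<open>The Mazur-Orlicz construction: \<open>r z\<close> is the infimum of
  \<open>q (z + u) - s\<close> over \<open>(u, s)\<close> in the cone \<open>D\<close>. By
  subadditivity and \<open>s \<le> q u\<close> every term is at least \<open>- q (- z)\<close>, so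
  the infimum is finite. For an odd functional below \<open>r\<close> the last conclusion becomes
  \<open>s \<le> r u\<close>.\<close>

lemma sublin_below_cone:
  assumes q: "sublin q" and D: "D \<noteq> {}"
    and Dc: "\<And>u s. (u, s) \<in> D \<Longrightarrow> u \<in> carrier E \<and> s \<in> borel_measurable M \<and> (AE w in M. s w \<le> q u w)"
    and Da: "\<And>u s u' s'. (u, s) \<in> D \<Longrightarrow> (u', s') \<in> D \<Longrightarrow> (u \<oplus>\<^bsub>E\<^esub> u', \<lambda>w. s w + s' w) \<in> D"
    and Dm: "\<And>u s \<xi>. (u, s) \<in> D \<Longrightarrow> \<xi> \<in> borel_measurable M \<Longrightarrow> (\<And>w. 0 \<le> \<xi> w) \<Longrightarrow>
      (rsc \<xi> u, \<lambda>w. \<xi> w * s w) \<in> D"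
  obtains r where "sublin r" "le_fun r q" "\<And>u s. (u, s) \<in> D \<Longrightarrow> AE w in M. r (\<ominus>\<^bsub>E\<^esub> u) w \<le> - s w"
proof -
  define T where "T = (\<lambda>(u, s) z w. q (z \<oplus>\<^bsub>E\<^esub> u) w - s w) ` D"
  have T: "\<exists>u s. (u, s) \<in> D \<and> t = (\<lambda>z w. q (z \<oplus>\<^bsub>E\<^esub> u) w - s w)" if "t \<in> T" for t
    using that by (auto simp: T_def)
  have TI: "(\<lambda>z w. q (z \<oplus>\<^bsub>E\<^esub> u) w - s w) \<in> T" if "(u, s) \<in> D" for u s
    using that by (force simp: T_def)
  note qm = sublinD(1)[OF q] and qa = sublinD(2)[OF q] and qh = sublinD(3)[OF q]
  obtain r where r: "sublin r" "\<And>t. t \<in> T \<Longrightarrow> le_fun r t"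
  proof (rule sublin_ess_inf[of T "\<lambda>z w. - q (\<ominus>\<^bsub>E\<^esub> z) w"])
    show "T \<noteq> {}" using D by (simp add: T_def)
    show "t z \<in> borel_measurable M" if "t \<in> T" "z \<in> carrier E" for t z
    proof -
      obtain u s where us: "(u, s) \<in> D" "t = (\<lambda>z w. q (z \<oplus>\<^bsub>E\<^esub> u) w - s w)"
        using T[OF \<open>t \<in> T\<close>] by blast
      then have "q (z \<oplus>\<^bsub>E\<^esub> u) \<in> borel_measurable M" "s \<in> borel_measurable M"
        using Dc[OF us(1)] that(2) qm by auto
      then show ?thesis by (simp add: us(2))
    qed
    show "(\<lambda>w. - q (\<ominus>\<^bsub>E\<^esub> z) w) \<in> borel_measurable M" if "z \<in> carrier E" for z
      using that qm[of "\<ominus>\<^bsub>E\<^esub> z"] by simp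
    show "AE w in M. - q (\<ominus>\<^bsub>E\<^esub> z) w \<le> t z w" if "t \<in> T" and z: "z \<in> carrier E" for t z
    proof -
      obtain u s where us: "(u, s) \<in> D" "t = (\<lambda>z w. q (z \<oplus>\<^bsub>E\<^esub> u) w - s w)"
        using T[OF \<open>t \<in> T\<close>] by blast
      then have u: "u \<in> carrier E" "AE w in M. s w \<le> q u w" using Dc by auto
      have "z \<oplus>\<^bsub>E\<^esub> u \<oplus>\<^bsub>E\<^esub> \<ominus>\<^bsub>E\<^esub> z = u" using z u(1) by (metis M.a_closed M.a_comm M.a_inv_closed M.r_neg1)
      then have "AE w in M. q u w \<le> q (z \<oplus>\<^bsub>E\<^esub> u) w + q (\<ominus>\<^bsub>E\<^esub> z) w"
        using qa[of "z \<oplus>\<^bsub>E\<^esub> u" "\<ominus>\<^bsub>E\<^esub> z"] z u(1) by simp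
      with u(2) show ?thesis unfolding us(2) by eventually_elim simp
    qed
    show "\<exists>u\<in>T. AE w in M. u (y \<oplus>\<^bsub>E\<^esub> z) w \<le> t y w + t' z w"
      if "t \<in> T" "t' \<in> T" and yz: "y \<in> carrier E" "z \<in> carrier E" for t t' y z
    proof -
      obtain u s where us: "(u, s) \<in> D" "t = (\<lambda>z w. q (z \<oplus>\<^bsub>E\<^esub> u) w - s w)"
        using T[OF \<open>t \<in> T\<close>] by blast
      obtain u' s' where us': "(u', s') \<in> D" "t' = (\<lambda>z w. q (z \<oplus>\<^bsub>E\<^esub> u') w - s' w)"
        using T[OF \<open>t' \<in> T\<close>] by blast
      have u: "u \<in> carrier E" "u' \<in> carrier E" using us us' Dc by auto
      have "y \<oplus>\<^bsub>E\<^esub> z \<oplus>\<^bsub>E\<^esub> (u \<oplus>\<^bsub>E\<^esub> u') = (y \<oplus>\<^bsub>E\<^esub> u) \<oplus>\<^bsub>E\<^esub> (z \<oplus>\<^bsub>E\<^esub> u')"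
        using yz u by (simp add: M.a_ac)
      then have "AE w in M. q (y \<oplus>\<^bsub>E\<^esub> z \<oplus>\<^bsub>E\<^esub> (u \<oplus>\<^bsub>E\<^esub> u')) w - (s w + s' w) \<le> t y w + t' z w"
        using qa[of "y \<oplus>\<^bsub>E\<^esub> u" "z \<oplus>\<^bsub>E\<^esub> u'"] yz u unfolding us(2) us'(2) by simp
      then show ?thesis
        by (rule bexI[of _ "\<lambda>z w. q (z \<oplus>\<^bsub>E\<^esub> (u \<oplus>\<^bsub>E\<^esub> u')) w - (s w + s' w)"])
          (rule TI[OF Da[OF us(1) us'(1)]])
    qed
    show "\<exists>u\<in>T. AE w in M. u (rsc \<xi> z) w \<le> \<xi> w * t z w"
      if "t \<in> T" and \<xi>: "\<xi> \<in> borel_measurable M" "\<And>w. 0 \<le> \<xi> w" and z: "z \<in> carrier E" for t \<xi> z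
    proof -
      obtain u s where us: "(u, s) \<in> D" "t = (\<lambda>z w. q (z \<oplus>\<^bsub>E\<^esub> u) w - s w)"
        using T[OF \<open>t \<in> T\<close>] by blast
      have u: "u \<in> carrier E" using us Dc by auto
      have "AE w in M. q (rsc \<xi> z \<oplus>\<^bsub>E\<^esub> rsc \<xi> u) w - \<xi> w * s w \<le> \<xi> w * t z w"
        using qh[OF \<xi>, of "z \<oplus>\<^bsub>E\<^esub> u"] u z \<xi>(1) unfolding us(2)
        by (simp add: rsc_add_right right_diff_distrib)
      then show ?thesis
        by (rule bexI[of _ "\<lambda>z w. q (z \<oplus>\<^bsub>E\<^esub> rsc \<xi> u) w - \<xi> w * s w"]) (rule TI[OF Dm[OF us(1) \<xi>]])
    qed
  qed blast
  show thesis
  proof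
    show "sublin r" by fact
    \<comment> \<open>Multiplying any pair of \<open>D\<close> by zero yields the zero pair, whose
      member of \<open>T\<close> is \<open>q\<close> itself; hence \<open>r\<close> is below
      \<open>q\<close>.\<close>
    obtain u s where us: "(u, s) \<in> D" using D by auto
    then have "(\<zero>\<^bsub>E\<^esub>, \<lambda>_. 0) \<in> D" using Dm[OF us, of "\<lambda>_. 0"] Dc[OF us] by simp
    from r(2)[OF TI[OF this]] show "le_fun r q" by (simp add: le_fun_def)
    show "AE w in M. r (\<ominus>\<^bsub>E\<^esub> u) w \<le> - s w" if "(u, s) \<in> D" for u s
    proof -
      have u: "u \<in> carrier E" using Dc that by auto
      show ?thesis using le_funD[OF r(2)[OF TI[OF that]], of "\<ominus>\<^bsub>E\<^esub> u"] sublin_zero[OF q] u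
        by (auto simp: M.l_neg elim: eventually_elim2)
    qed
  qed
qed

text \<open>A minimal sublinear functional is odd: otherwise \<open>sublin_below_cone\<close> for the cone spanned by
  \<open>(x, r x)\<close> would give a smaller one. Since \<open>le_fun\<close> is only a preorder, the minimal one is obtained
  from a maximal chain.\<close>

lemma Hahn_Banach_sublin:
  assumes q: "sublin q"
  obtains r where "sublin r" "le_fun r q" "\<And>z. z \<in> carrier E \<Longrightarrow> AE w in M. r (\<ominus>\<^bsub>E\<^esub> z) w = - r z w"
proof -
  interpret pred_on "{r. sublin r \<and> le_fun r q}" le_fun .
  obtain C where mc: "maxchain C" using Hausdorff ..
  then have C: "\<And>r. r \<in> C \<Longrightarrow> sublin r" "\<And>r. r \<in> C \<Longrightarrow> le_fun r q"
    by (auto simp: maxchain_def chain_def)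
  have refl: "le_fun r r" for r by (simp add: le_fun_def)
  have tot: "le_fun r s \<or> le_fun s r" if "r \<in> C" "s \<in> C" for r s
    using chain_total[OF maxchain_imp_chain[OF mc] that] refl by auto
  \<comment> \<open>A sublinear \<open>s\<close> below the whole chain is comparable with all its
    members, so maximality forces \<open>s\<close> into \<open>C\<close>.\<close>
  have mem: "s \<in> C" if s: "sublin s" "le_fun s q" "\<And>r. r \<in> C \<Longrightarrow> le_fun s r" for s
  proof (rule ccontr)
    assume "s \<notin> C"
    moreover have "chain (insert s C)"
      using maxchain_imp_chain[OF mc] s by (auto simp: chain_def)
    ultimately show False using mc by (auto simp: maxchain_def)
  qed
  have ne: "C \<noteq> {}" using mem[of q] q refl by auto
  then obtain c where c: "c \<in> C" by blast
  obtain r where r: "sublin r" "\<And>t. t \<in> C \<Longrightarrow> le_fun r t"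
  proof (rule sublin_ess_inf[of C "\<lambda>z w. - c (\<ominus>\<^bsub>E\<^esub> z) w"])
    show "t z \<in> borel_measurable M" if "t \<in> C" "z \<in> carrier E" for t z
      using sublinD(1)[OF C(1)] that by blast
    show "(\<lambda>w. - c (\<ominus>\<^bsub>E\<^esub> z) w) \<in> borel_measurable M" if "z \<in> carrier E" for z
      using sublinD(1)[OF C(1)[OF c], of "\<ominus>\<^bsub>E\<^esub> z"] that by simp
    \<comment> \<open>One fixed \<open>c\<close> bounds the whole chain: either
      \<open>t \<le> c\<close>, and \<open>t z \<ge> - t (- z) \<ge> - c (- z)\<close>, or
      \<open>c \<le> t\<close>, and \<open>t z \<ge> c z \<ge> - c (- z)\<close>.\<close>
    show "AE w in M. - c (\<ominus>\<^bsub>E\<^esub> z) w \<le> t z w" if t: "t \<in> C" and z: "z \<in> carrier E" for t z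
      using tot[OF t c]
    proof
      assume "le_fun t c"
      from le_funD[OF this, of "\<ominus>\<^bsub>E\<^esub> z"] sublin_uminus_ge[OF C(1)[OF t] z]
      show ?thesis using z by (auto elim: eventually_elim2)
    next
      assume "le_fun c t"
      from le_funD[OF this z] sublin_uminus_ge[OF C(1)[OF c] z] show ?thesis
        by eventually_elim simp
    qed
    \<comment> \<open>The smaller of the two comparable functionals serves as
      \<open>u\<close>.\<close>
    show "\<exists>u\<in>C. AE w in M. u (y \<oplus>\<^bsub>E\<^esub> z) w \<le> t y w + t' z w"
      if t: "t \<in> C" "t' \<in> C" and yz: "y \<in> carrier E" "z \<in> carrier E" for t t' y z
      using tot[OF t]
    proof
      assume le: "le_fun t t'"
      have "AE w in M. t (y \<oplus>\<^bsub>E\<^esub> z) w \<le> t y w + t' z w"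
        using sublinD(2)[OF C(1)[OF t(1)] yz] le_funD[OF le yz(2)] by eventually_elim simp
      then show ?thesis using t by blast
    next
      assume le: "le_fun t' t"
      have "AE w in M. t' (y \<oplus>\<^bsub>E\<^esub> z) w \<le> t y w + t' z w"
        using sublinD(2)[OF C(1)[OF t(2)] yz] le_funD[OF le yz(1)] by eventually_elim simp
      then show ?thesis using t by blast
    qed
    show "\<exists>u\<in>C. AE w in M. u (rsc \<xi> z) w \<le> \<xi> w * t z w"
      if "t \<in> C" "\<xi> \<in> borel_measurable M" "\<And>w. 0 \<le> \<xi> w" "z \<in> carrier E" for t \<xi> z
      using sublinD(3)[OF C(1)] that by blast
  qed (use ne in blast)+
  have rq: "le_fun r q" using le_fun_trans[OF r(2)[OF c] C(2)[OF c]] .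
  show thesis
  proof (rule that[OF r(1) rq])
    fix x assume x: "x \<in> carrier E"
    let ?D = "{(rsc \<xi> x, \<lambda>w. \<xi> w * r x w) |\<xi>. \<xi> \<in> borel_measurable M \<and> (\<forall>w. 0 \<le> \<xi> w)}"
    have rx: "r x \<in> borel_measurable M" using sublinD(1)[OF r(1) x] .
    obtain s where s: "sublin s" "le_fun s r" "\<And>u t. (u, t) \<in> ?D \<Longrightarrow> AE w in M. s (\<ominus>\<^bsub>E\<^esub> u) w \<le> - t w"
    proof (rule sublin_below_cone[OF r(1), of ?D])
      show "?D \<noteq> {}" by (auto intro!: exI[of _ "\<lambda>_. 0"])
      show "u \<in> carrier E \<and> t \<in> borel_measurable M \<and> (AE w in M. t w \<le> r u w)" if ut: "(u, t) \<in> ?D" for u t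
      proof -
        obtain \<xi> where \<xi>: "u = rsc \<xi> x" "t = (\<lambda>w. \<xi> w * r x w)" "\<xi> \<in> borel_measurable M" "\<forall>w. 0 \<le> \<xi> w"
          using ut by blast
        \<comment> \<open>The condition \<open>t \<le> r u\<close> on the pairs is the reverse
          inequality of homogeneity, hence the appeal to the full equality.\<close>
        have "AE w in M. r (rsc \<xi> x) w = \<xi> w * r x w"
          using \<xi>(4) by (intro sublin_homogeneous[OF r(1) \<xi>(3) _ x]) simp
        then have "AE w in M. t w \<le> r u w"
          unfolding \<xi>(1,2) by eventually_elim simp
        then show ?thesis using \<xi> x rx by simp
      qed
      show "(u \<oplus>\<^bsub>E\<^esub> u', \<lambda>w. t w + t' w) \<in> ?D" if ut: "(u, t) \<in> ?D" "(u', t') \<in> ?D" for u t u' t'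
      proof -
        obtain \<xi> \<xi>' where "u = rsc \<xi> x" "t = (\<lambda>w. \<xi> w * r x w)" "\<xi> \<in> borel_measurable M" "\<forall>w. 0 \<le> \<xi> w"
          "u' = rsc \<xi>' x" "t' = (\<lambda>w. \<xi>' w * r x w)" "\<xi>' \<in> borel_measurable M" "\<forall>w. 0 \<le> \<xi>' w"
          using ut by blast
        then show ?thesis
          using x by (auto simp: rsc_add_left distrib_right intro!: exI[of _ "\<lambda>w. \<xi> w + \<xi>' w"])
      qed
      show "(rsc \<eta> u, \<lambda>w. \<eta> w * t w) \<in> ?D"
        if ut: "(u, t) \<in> ?D" "\<eta> \<in> borel_measurable M" "\<And>w. 0 \<le> \<eta> w" for u t \<eta>
      proof -
        obtain \<xi> where "u = rsc \<xi> x" "t = (\<lambda>w. \<xi> w * r x w)" "\<xi> \<in> borel_measurable M" "\<forall>w. 0 \<le> \<xi> w"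
          using ut by blast
        then show ?thesis
          using x that by (auto simp: rsc_rsc mult.assoc intro!: exI[of _ "\<lambda>w. \<eta> w * \<xi> w"])
      qed
    qed blast
    have "(rsc (\<lambda>_. 1) x, \<lambda>w. 1 * r x w) \<in> ?D" by (intro CollectI exI[of _ "\<lambda>_. 1"]) simp
    from s(3)[OF this] have "AE w in M. s (\<ominus>\<^bsub>E\<^esub> x) w \<le> - r x w" using x by simp
    \<comment> \<open>Being below \<open>r\<close>, the functional \<open>s\<close> is below the
      chain and so belongs to it; hence also \<open>r \<le> s\<close>. This yields
      \<open>r (- x) \<le> s (- x) \<le> - r x\<close>, and the opposite inequality holds for every
      sublinear functional.\<close>
    moreover have "s \<in> C" using s r by (intro mem) (blast intro: le_fun_trans rq)+
    then have "le_fun r s" by (rule r(2))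
    from le_funD[OF this] have "AE w in M. r (\<ominus>\<^bsub>E\<^esub> x) w \<le> s (\<ominus>\<^bsub>E\<^esub> x) w" using x by simp
    moreover note sublin_uminus_ge[OF r(1) x]
    ultimately show "AE w in M. r (\<ominus>\<^bsub>E\<^esub> x) w = - r x w" by eventually_elim simp
  qed
qed

text \<open>Oddness reverses subadditivity by passing to negatives. A multiplier of arbitrary sign
  is split into its positive and negative parts.\<close>

lemma
  assumes r: "sublin r" and odd: "\<And>z. z \<in> carrier E \<Longrightarrow> AE w in M. r (\<ominus>\<^bsub>E\<^esub> z) w = - r z w"
  shows odd_sublin_add: "y \<in> carrier E \<Longrightarrow> z \<in> carrier E \<Longrightarrow> AE w in M. r (y \<oplus>\<^bsub>E\<^esub> z) w = r y w + r z w"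
    and odd_sublin_scale: "\<xi> \<in> borel_measurable M \<Longrightarrow> z \<in> carrier E \<Longrightarrow> AE w in M. r (rsc \<xi> z) w = \<xi> w * r z w"
proof -
  show add: "AE w in M. r (y \<oplus>\<^bsub>E\<^esub> z) w = r y w + r z w" if yz: "y \<in> carrier E" "z \<in> carrier E" for y z
  proof -
    have "AE w in M. r (\<ominus>\<^bsub>E\<^esub> (y \<oplus>\<^bsub>E\<^esub> z)) w \<le> r (\<ominus>\<^bsub>E\<^esub> y) w + r (\<ominus>\<^bsub>E\<^esub> z) w"
      using sublinD(2)[OF r, of "\<ominus>\<^bsub>E\<^esub> y" "\<ominus>\<^bsub>E\<^esub> z"] yz by (simp add: M.minus_add)
    with sublinD(2)[OF r yz] odd[OF yz(1)] odd[OF yz(2)] odd[OF M.a_closed[OF yz]] show ?thesis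
      by eventually_elim simp
  qed
  show "AE w in M. r (rsc \<xi> z) w = \<xi> w * r z w" if \<xi>: "\<xi> \<in> borel_measurable M" and z: "z \<in> carrier E" for \<xi> z
  proof -
    let ?p = "\<lambda>w. max 0 (\<xi> w)" and ?n = "\<lambda>w. max 0 (- \<xi> w)"
    have m: "?p \<in> borel_measurable M" "?n \<in> borel_measurable M" "(\<lambda>w. - ?n w) \<in> borel_measurable M" using \<xi> by simp_all
    have "(\<lambda>w. ?p w + - ?n w) = \<xi>" by (auto simp: fun_eq_iff max_def)
    then have "rsc \<xi> z = rsc ?p z \<oplus>\<^bsub>E\<^esub> \<ominus>\<^bsub>E\<^esub> rsc ?n z"
      using rsc_add_left[OF m(1,3) z] rsc_uminus[OF m(2) z] by simp
    then have "AE w in M. r (rsc \<xi> z) w = r (rsc ?p z) w + r (\<ominus>\<^bsub>E\<^esub> rsc ?n z) w"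
      using add[of "rsc ?p z" "\<ominus>\<^bsub>E\<^esub> rsc ?n z"] m z by simp
    moreover have "AE w in M. r (\<ominus>\<^bsub>E\<^esub> rsc ?n z) w = - r (rsc ?n z) w" using odd m z by simp
    moreover have "AE w in M. r (rsc ?p z) w = ?p w * r z w" "AE w in M. r (rsc ?n z) w = ?n w * r z w"
      using sublin_homogeneous[OF r _ _ z] m by simp_all
    ultimately show ?thesis by eventually_elim (auto simp: max_def)
  qed
qed

end

section \<open>Separation in random locally convex modules\<close>

locale L0_seminormed_module = L0_module M E
  for M :: "'w measure"
    and E :: "(('w \<Rightarrow> 'k::{real_normed_field, second_countable_topology}) set, 'a) module" +
  fixes P :: "('a \<Rightarrow> ('w \<Rightarrow> real) set) set"
  assumes seminorms: "\<forall>p\<in>P. L0_seminorm M E p"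
begin

section \<open>Seminorms through representatives\<close>

text \<open>A representative is chosen for each vector separately, so every seminorm law for
  \<open>nu p\<close> holds off a null set that depends on the vectors involved.\<close>

definition nu :: "('a \<Rightarrow> ('w \<Rightarrow> real) set) \<Rightarrow> 'a \<Rightarrow> 'w \<Rightarrow> real" where
  "nu p z = L0_rep (p z)"

lemma seminorm_closed: "p \<in> P \<Longrightarrow> z \<in> carrier E \<Longrightarrow> p z \<in> L0_plus M"
  using seminorms by (auto simp: L0_seminorm_def)

lemma seminorm_L0: "p \<in> P \<Longrightarrow> z \<in> carrier E \<Longrightarrow> p z \<in> L0 M"
  using seminorm_closed by (simp add: L0_plus_def)

lemma nu_measurable [measurable]: "p \<in> P \<Longrightarrow> z \<in> carrier E \<Longrightarrow> nu p z \<in> borel_measurable M"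
  and cls_nu: "p \<in> P \<Longrightarrow> z \<in> carrier E \<Longrightarrow> cls M (nu p z) = p z"
  unfolding nu_def by (simp_all add: L0_rep_measurable cls_L0_rep seminorm_L0)

lemma nu_nonneg:
  assumes "p \<in> P" "z \<in> carrier E"
  shows "AE w in M. 0 \<le> nu p z w"
  using seminorm_closed[OF assms] L0_plus_cls[OF nu_measurable[OF assms]] cls_nu[OF assms] by simp

lemma nu_add:
  assumes p: "p \<in> P" and yz: "y \<in> carrier E" "z \<in> carrier E"
  shows "AE w in M. nu p (y \<oplus>\<^bsub>E\<^esub> z) w \<le> nu p y w + nu p z w"
proof -
  have m [measurable]: "nu p y \<in> borel_measurable M" "nu p z \<in> borel_measurable M"
    "nu p (y \<oplus>\<^bsub>E\<^esub> z) \<in> borel_measurable M" using assms by auto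
  have "p (y \<oplus>\<^bsub>E\<^esub> z) \<sqsubseteq>\<^bsub>L0_ord M\<^esub> p y \<oplus>\<^bsub>L0_alg M\<^esub> p z"
    using seminorms assms by (auto simp: L0_seminorm_def)
  then have "cls M (nu p (y \<oplus>\<^bsub>E\<^esub> z)) \<sqsubseteq>\<^bsub>L0_ord M\<^esub> cls M (nu p y) \<oplus>\<^bsub>L0_alg M\<^esub> cls M (nu p z)"
    using assms by (simp add: cls_nu)
  then show ?thesis by (simp add: L0_alg_simps m le_cls)
qed

lemma nu_smult:
  assumes p: "p \<in> P" and f: "f \<in> borel_measurable M" and z: "z \<in> carrier E"
  shows "AE w in M. nu p (cls M f \<odot>\<^bsub>E\<^esub> z) w = norm (f w) * nu p z w"
proof -
  have fz: "cls M f \<odot>\<^bsub>E\<^esub> z \<in> carrier E" using f z by (intro smult_closed) simp_all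
  note [measurable] = nu_measurable[OF p z] nu_measurable[OF p fz] f
  have "p (cls M f \<odot>\<^bsub>E\<^esub> z) = lift1 M norm (cls M f) \<otimes>\<^bsub>L0_alg M\<^esub> p z"
    using seminorms p f z by (auto simp: L0_seminorm_def)
  also have "\<dots> = cls M (\<lambda>w. norm (f w)) \<otimes>\<^bsub>L0_alg M\<^esub> cls M (nu p z)"
    using f by (simp add: lift1_cls cls_nu[OF p z])
  also have "\<dots> = cls M (\<lambda>w. norm (f w) * nu p z w)" by (simp add: L0_alg_simps)
  finally have "cls M (nu p (cls M f \<odot>\<^bsub>E\<^esub> z)) = cls M (\<lambda>w. norm (f w) * nu p z w)"
    by (simp add: cls_nu[OF p fz])
  then show ?thesis by (simp add: cls_eq_iff)
qed

lemma nu_rsc: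
  assumes "p \<in> P" "\<xi> \<in> borel_measurable M" "z \<in> carrier E"
  shows "AE w in M. nu p (rsc \<xi> z) w = \<bar>\<xi> w\<bar> * nu p z w"
  using nu_smult[OF assms(1) of_real_measurable[OF assms(2)] assms(3)] by (simp add: rsc_def)

lemma sublin_nu: "p \<in> P \<Longrightarrow> sublin (nu p)"
  unfolding sublin_def
proof (intro conjI ballI impI)
  fix \<xi> :: "'w \<Rightarrow> real" and z
  assume *: "p \<in> P" "\<xi> \<in> borel_measurable M" "\<forall>w. 0 \<le> \<xi> w" "z \<in> carrier E"
  show "AE w in M. nu p (rsc \<xi> z) w \<le> \<xi> w * nu p z w"
    using nu_rsc[OF *(1,2,4)] by eventually_elim (simp add: *(3))
qed (auto intro: nu_add)

text \<open>On \<open>B\<close> both values coincide with the seminorm of the vector cut off by the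
  indicator of \<open>B\<close>.\<close>

lemma nu_local:
  assumes p: "p \<in> P" and B: "B \<in> sets M" and yz: "y \<in> carrier E" "z \<in> carrier E"
    and eq: "rsc (indicator B) y = rsc (indicator B) z"
  shows "AE w in M. w \<in> B \<longrightarrow> nu p y w = nu p z w"
proof -
  have "(indicator B :: 'w \<Rightarrow> real) \<in> borel_measurable M" using B by simp
  from nu_rsc[OF p this yz(1)] nu_rsc[OF p this yz(2)] show ?thesis
    unfolding eq by eventually_elim (auto simp: indicator_def split: if_splits)
qed

lemma L0_indicator_smult: "L0_indicator M B \<odot>\<^bsub>E\<^esub> z = rsc (indicator B) z"
proof -
  have "(\<lambda>w. of_real (indicator B w) :: 'k) = indicator B" by (auto simp: indicator_def)
  then show ?thesis by (simp add: rsc_def L0_indicator_def)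
qed

lemma rsc_sub:
  assumes "\<xi> \<in> borel_measurable M" "y \<in> carrier E" "z \<in> carrier E"
  shows "rsc \<xi> (y \<ominus>\<^bsub>E\<^esub> z) = rsc \<xi> y \<oplus>\<^bsub>E\<^esub> \<ominus>\<^bsub>E\<^esub> rsc \<xi> z"
  using assms by (simp add: a_minus_def rsc_add_right rsc_minus_right)

lemma L0_convexD:
  assumes G: "L0_convex M E G" and yz: "y \<in> G" "z \<in> G"
    and \<xi>: "\<xi> \<in> borel_measurable M" "\<And>w. 0 \<le> \<xi> w" "\<And>w. \<xi> w \<le> 1"
  shows "rsc \<xi> y \<oplus>\<^bsub>E\<^esub> rsc (\<lambda>w. 1 - \<xi> w) z \<in> G"
proof -
  have "cls M \<xi> \<in> L0_plus M" "cls M \<xi> \<sqsubseteq>\<^bsub>L0_ord M\<^esub> cls M (\<lambda>_. 1)"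
    using \<xi> by (simp_all add: L0_plus_cls le_cls)
  then have "(lift1 M of_real (cls M \<xi>) \<odot>\<^bsub>E\<^esub> y) \<oplus>\<^bsub>E\<^esub> (lift1 M (\<lambda>t. of_real (1 - t)) (cls M \<xi>) \<odot>\<^bsub>E\<^esub> z) \<in> G"
    using G yz unfolding L0_convex_def by blast
  moreover have "lift1 M (of_real :: real \<Rightarrow> 'k) (cls M \<xi>) = cls M (\<lambda>w. of_real (\<xi> w))"
    using \<xi>(1) by (intro lift1_cls) auto
  moreover have "lift1 M (\<lambda>t. of_real (1 - t) :: 'k) (cls M \<xi>) = cls M (\<lambda>w. of_real (1 - \<xi> w))"
    using \<xi>(1) by (intro lift1_cls of_real_measurable) auto
  ultimately show ?thesis unfolding rsc_def by (simp only:)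
qed

section \<open>The separating functional for a given seminorm and margin\<close>

text \<open>The cone construction is applied to \<open>nu p\<close> and the cone generated by the
  pairs \<open>(x - y, d)\<close> with \<open>y\<close> in \<open>G\<close>; a linear minorant of
  the result is then at least \<open>d\<close> on every \<open>x - y\<close>. Convexity of
  \<open>G\<close> makes the cone closed under addition.\<close>

lemma separating_functional:
  assumes p: "p \<in> P" and d: "d \<in> borel_measurable M"
    and x: "x \<in> carrier E" and G: "L0_convex M E G" "G \<noteq> {}"
    and dist: "\<And>y. y \<in> G \<Longrightarrow> AE w in M. d w \<le> nu p (x \<ominus>\<^bsub>E\<^esub> y) w"
  obtains r where
    "\<And>z. z \<in> carrier E \<Longrightarrow> r z \<in> borel_measurable M"
    "\<And>y z. y \<in> carrier E \<Longrightarrow> z \<in> carrier E \<Longrightarrow> AE w in M. r (y \<oplus>\<^bsub>E\<^esub> z) w = r y w + r z w"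
    "\<And>\<xi> z. \<xi> \<in> borel_measurable M \<Longrightarrow> z \<in> carrier E \<Longrightarrow> AE w in M. r (rsc \<xi> z) w = \<xi> w * r z w"
    "\<And>z. z \<in> carrier E \<Longrightarrow> AE w in M. \<bar>r z w\<bar> \<le> nu p z w"
    "\<And>y. y \<in> G \<Longrightarrow> AE w in M. r y w + d w \<le> r x w"
proof -
  have Gc: "y \<in> carrier E" if "y \<in> G" for y using G that by (auto simp: L0_convex_def)
  let ?D = "{(rsc \<xi> (x \<ominus>\<^bsub>E\<^esub> y), \<lambda>w. \<xi> w * d w) |\<xi> y. \<xi> \<in> borel_measurable M \<and> (\<forall>w. 0 \<le> \<xi> w) \<and> y \<in> G}"
  have DI: "(rsc \<xi> (x \<ominus>\<^bsub>E\<^esub> y), \<lambda>w. \<xi> w * d w) \<in> ?D"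
    if "\<xi> \<in> borel_measurable M" "\<And>w. 0 \<le> \<xi> w" "y \<in> G" for \<xi> y using that by blast
  obtain q where q: "sublin q" "le_fun q (nu p)" "\<And>u t. (u, t) \<in> ?D \<Longrightarrow> AE w in M. q (\<ominus>\<^bsub>E\<^esub> u) w \<le> - t w"
  proof (rule sublin_below_cone[OF sublin_nu[OF p], of ?D])
    obtain y where "y \<in> G" using G by blast
    then show "?D \<noteq> {}" using DI[of "\<lambda>_. 0" y] by auto
    show "u \<in> carrier E \<and> t \<in> borel_measurable M \<and> (AE w in M. t w \<le> nu p u w)" if ut: "(u, t) \<in> ?D" for u t
    proof -
      obtain \<xi> y where \<xi>: "u = rsc \<xi> (x \<ominus>\<^bsub>E\<^esub> y)" "t = (\<lambda>w. \<xi> w * d w)" "\<xi> \<in> borel_measurable M"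
        "\<forall>w. 0 \<le> \<xi> w" "y \<in> G"
        using ut by blast
      have xy: "x \<ominus>\<^bsub>E\<^esub> y \<in> carrier E" using x Gc[OF \<xi>(5)] by simp
      from nu_rsc[OF p \<xi>(3) xy] dist[OF \<xi>(5)] have "AE w in M. t w \<le> nu p u w"
        unfolding \<xi>(1,2) by eventually_elim (simp add: \<xi>(4) mult_left_mono)
      then show ?thesis using \<xi> xy d by simp
    qed
    show "(u \<oplus>\<^bsub>E\<^esub> u', \<lambda>w. t w + t' w) \<in> ?D" if ut: "(u, t) \<in> ?D" "(u', t') \<in> ?D" for u t u' t'
    proof -
      obtain \<xi> y where \<xi>: "u = rsc \<xi> (x \<ominus>\<^bsub>E\<^esub> y)" "t = (\<lambda>w. \<xi> w * d w)" "\<xi> \<in> borel_measurable M"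
        "\<forall>w. 0 \<le> \<xi> w" "y \<in> G"
        using ut(1) by blast
      obtain \<xi>' y' where \<xi>': "u' = rsc \<xi>' (x \<ominus>\<^bsub>E\<^esub> y')" "t' = (\<lambda>w. \<xi>' w * d w)" "\<xi>' \<in> borel_measurable M"
        "\<forall>w. 0 \<le> \<xi>' w" "y' \<in> G"
        using ut(2) by blast
      \<comment> \<open>Where \<open>s\<close> vanishes so do \<open>\<xi>\<close> and \<open>\<xi>'\<close>, so the junk value \<open>\<zeta> = 0\<close> is harmless.\<close>
      define s where "s w = \<xi> w + \<xi>' w" for w
      define \<zeta> where "\<zeta> w = \<xi> w / s w" for w
      have m [measurable]: "s \<in> borel_measurable M" "\<zeta> \<in> borel_measurable M"
        unfolding s_def[abs_def] \<zeta>_def[abs_def] using \<xi>(3) \<xi>'(3) by measurable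
      have \<zeta>01: "0 \<le> \<zeta> w" "\<zeta> w \<le> 1" for w
        using \<xi>(4)[rule_format, of w] \<xi>'(4)[rule_format, of w]
        by (simp_all add: \<zeta>_def s_def divide_le_eq_1) linarith
      have s: "s w * \<zeta> w = \<xi> w" "s w * (1 - \<zeta> w) = \<xi>' w" for w
      proof -
        have "s w = 0 \<Longrightarrow> \<xi> w = 0 \<and> \<xi>' w = 0"
          using \<xi>(4)[rule_format, of w] \<xi>'(4)[rule_format, of w] by (simp add: s_def)
        then show "s w * \<zeta> w = \<xi> w" by (auto simp: \<zeta>_def)
        then show "s w * (1 - \<zeta> w) = \<xi>' w" by (simp add: right_diff_distrib) (simp add: s_def)
      qed
      \<comment> \<open>The mean of \<open>y\<close> and \<open>y'\<close> with weights proportional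
        to \<open>\<xi>\<close> and \<open>\<xi>'\<close>, so that
        \<open>\<xi> (x - y) + \<xi>' (x - y') = s (x - y'')\<close>.\<close>
      define y'' where "y'' = rsc \<zeta> y \<oplus>\<^bsub>E\<^esub> rsc (\<lambda>w. 1 - \<zeta> w) y'"
      have y'': "y'' \<in> G" unfolding y''_def by (rule L0_convexD[OF G(1) \<xi>(5) \<xi>'(5) m(2) \<zeta>01])
      have c: "y \<in> carrier E" "y' \<in> carrier E" "y'' \<in> carrier E" using Gc \<xi>(5) \<xi>'(5) y'' by auto
      have "rsc s y'' = rsc \<xi> y \<oplus>\<^bsub>E\<^esub> rsc \<xi>' y'"
        unfolding y''_def using c by (simp add: rsc_add_right rsc_rsc s)
      moreover have "rsc s x = rsc \<xi> x \<oplus>\<^bsub>E\<^esub> rsc \<xi>' x"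
        unfolding s_def[abs_def] using \<xi>(3) \<xi>'(3) x by (rule rsc_add_left)
      ultimately have "rsc s (x \<ominus>\<^bsub>E\<^esub> y'') = u \<oplus>\<^bsub>E\<^esub> u'"
        unfolding \<xi>(1) \<xi>'(1) using x c \<xi>(3) \<xi>'(3) by (simp add: rsc_sub M.minus_add M.a_ac)
      moreover have "(\<lambda>w. s w * d w) = (\<lambda>w. t w + t' w)"
        by (simp add: s_def \<xi>(2) \<xi>'(2) distrib_right)
      moreover have "0 \<le> s w" for w using \<xi>(4) \<xi>'(4) by (simp add: s_def)
      ultimately show ?thesis using DI[OF m(1) _ y''] by simp
    qed
    show "(rsc \<eta> u, \<lambda>w. \<eta> w * t w) \<in> ?D"
      if ut: "(u, t) \<in> ?D" and \<eta>: "\<eta> \<in> borel_measurable M" "\<And>w. 0 \<le> \<eta> w" for u t \<eta>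
    proof -
      obtain \<xi> y where \<xi>: "u = rsc \<xi> (x \<ominus>\<^bsub>E\<^esub> y)" "t = (\<lambda>w. \<xi> w * d w)" "\<xi> \<in> borel_measurable M"
        "\<forall>w. 0 \<le> \<xi> w" "y \<in> G"
        using ut by blast
      then show ?thesis
        using DI[of "\<lambda>w. \<eta> w * \<xi> w" y] x Gc[OF \<xi>(5)] \<eta> by (simp add: rsc_rsc mult.assoc)
    qed
  qed blast
  obtain r where r: "sublin r" "le_fun r q" "\<And>z. z \<in> carrier E \<Longrightarrow> AE w in M. r (\<ominus>\<^bsub>E\<^esub> z) w = - r z w"
    using Hahn_Banach_sublin[OF q(1)] by blast
  have r_nu: "le_fun r (nu p)" using r(2) q(2) by (rule le_fun_trans)
  have add: "AE w in M. r (y \<oplus>\<^bsub>E\<^esub> z) w = r y w + r z w" if "y \<in> carrier E" "z \<in> carrier E" for y z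
    by (rule odd_sublin_add[OF r(1) _ that]) (rule r(3))
  show thesis
  proof
    show "r z \<in> borel_measurable M" if "z \<in> carrier E" for z using sublinD(1)[OF r(1) that] .
    show "AE w in M. r (y \<oplus>\<^bsub>E\<^esub> z) w = r y w + r z w" if "y \<in> carrier E" "z \<in> carrier E" for y z
      using add that .
    show "AE w in M. r (rsc \<xi> z) w = \<xi> w * r z w" if "\<xi> \<in> borel_measurable M" "z \<in> carrier E" for \<xi> z
      by (rule odd_sublin_scale[OF r(1) _ that]) (rule r(3))
    show "AE w in M. \<bar>r z w\<bar> \<le> nu p z w" if z: "z \<in> carrier E" for z
    proof -
      have "rsc (\<lambda>_. - 1) z = \<ominus>\<^bsub>E\<^esub> z" using rsc_uminus[of "\<lambda>_. 1" z] z by simp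
      then have "AE w in M. nu p (\<ominus>\<^bsub>E\<^esub> z) w = nu p z w" using nu_rsc[OF p _ z, of "\<lambda>_. - 1"] by simp
      moreover have "AE w in M. r (\<ominus>\<^bsub>E\<^esub> z) w \<le> nu p (\<ominus>\<^bsub>E\<^esub> z) w" using le_funD[OF r_nu] z by simp
      moreover note le_funD[OF r_nu z] r(3)[OF z]
      ultimately show ?thesis by eventually_elim simp
    qed
    show "AE w in M. r y w + d w \<le> r x w" if y: "y \<in> G" for y
    proof -
      have xy: "x \<ominus>\<^bsub>E\<^esub> y \<in> carrier E" "y \<in> carrier E" using x Gc[OF y] by auto
      have "AE w in M. q (\<ominus>\<^bsub>E\<^esub> (x \<ominus>\<^bsub>E\<^esub> y)) w \<le> - d w"
        using q(3)[OF DI[of "\<lambda>_. 1" y]] y xy by simp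
      moreover have "AE w in M. r (\<ominus>\<^bsub>E\<^esub> (x \<ominus>\<^bsub>E\<^esub> y)) w \<le> q (\<ominus>\<^bsub>E\<^esub> (x \<ominus>\<^bsub>E\<^esub> y)) w"
        using le_funD[OF r(2)] xy by simp
      moreover note r(3)[OF xy(1)] r(3)[OF xy(2)]
      moreover have "AE w in M. r (x \<ominus>\<^bsub>E\<^esub> y) w = r x w + r (\<ominus>\<^bsub>E\<^esub> y) w"
        unfolding a_minus_def using x xy by (intro add) simp_all
      ultimately show ?thesis by eventually_elim simp
    qed
  qed
qed

section \<open>Finite suprema of seminorms, concatenation, and the topology\<close>

lemma sup_norm_L0:
  assumes "Q \<in> fin_subfamilies P" "z \<in> carrier E"
  shows "sup_norm M Q z \<in> L0 M"
  using sup_norm_least[OF seminorms assms] by (auto simp: least_def Upper_def)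

lemma sup_norm_singleton:
  assumes "p \<in> P" "z \<in> carrier E"
  shows "sup_norm M {p} z = p z"
proof -
  interpret partial_order "L0_ord M :: ('w \<Rightarrow> real) set gorder" by (rule partial_order_L0_ord)
  have "least (L0_ord M) (sup_norm M {p} z) (Upper (L0_ord M) {p z})"
    using sup_norm_least[OF seminorms _ assms(2), of "{p}"] assms by (simp add: fin_subfamilies_def)
  moreover have "least (L0_ord M) (p z) (Upper (L0_ord M) {p z})"
    using seminorm_L0[OF assms] by (intro least_UpperI) (auto simp: Upper_def)
  ultimately show ?thesis by (rule least_unique)
qed

text \<open>Concatenation in terms of representatives: on each cell of the partition only the
  summand of that cell survives.\<close>

lemma concat_seminorms_mem:
  assumes c: "concat_seminorms M E P" and B: "countable_partition M B" and Q: "\<And>n. Q n \<in> fin_subfamilies P"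
  obtains p where "p \<in> P"
    "\<And>z. z \<in> carrier E \<Longrightarrow> AE w in M. \<forall>n. w \<in> B n \<longrightarrow> nu p z w = L0_rep (sup_norm M (Q n) z) w"
proof -
  let ?X = "\<lambda>z n. L0_indicator M (B n) \<otimes>\<^bsub>L0_alg M\<^esub> sup_norm M (Q n) z"
  let ?p = "\<lambda>z\<in>carrier E. L0_suminf M (?X z)"
  have p: "?p \<in> P" using c[unfolded concat_seminorms_def, rule_format, of B Q] B Q by simp
  have Bs: "B n \<in> sets M" for n using B by (auto simp: countable_partition_def)
  have dj: "disjoint_family B" using B by (simp add: countable_partition_def)
  have "AE w in M. \<forall>n. w \<in> B n \<longrightarrow> nu ?p z w = L0_rep (sup_norm M (Q n) z) w" if z: "z \<in> carrier E" for z
  proof -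
    let ?g = "\<lambda>n. L0_rep (sup_norm M (Q n) z)"
    have g: "?g n \<in> borel_measurable M" for n using sup_norm_L0[OF Q z] by (rule L0_rep_measurable)
    have X: "?X z n = cls M (\<lambda>w. indicator (B n) w * ?g n w)" for n
    proof -
      have "?X z n = cls M (indicator (B n)) \<otimes>\<^bsub>L0_alg M\<^esub> cls M (?g n)"
        by (simp add: L0_indicator_def cls_L0_rep[OF sup_norm_L0[OF Q z]])
      also have "\<dots> = cls M (\<lambda>w. indicator (B n) w * ?g n w)"
        using g Bs by (intro L0_alg_simps) simp_all
      finally show ?thesis .
    qed
    let ?h = "nu ?p z"
    have hp: "?p z \<in> L0 M" using p z by (rule seminorm_L0)
    have "?h \<in> ?p z"
      using nu_measurable[OF p z] cls_nu[OF p z] mem_cls[of ?h M ?h] by simp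
    then have "?h \<in> L0_suminf M (?X z)" using z by simp
    \<comment> \<open>The series of classes is a union over all choices of representatives. The
      function \<open>nu ?p z\<close> comes from one such choice \<open>f\<close>, which differs
      from the explicit summands on a countable union of null sets.\<close>
    then obtain f where f: "f \<in> Pi UNIV (?X z)" "?h \<in> cls M (\<lambda>w. \<Sum>n. f n w)"
      unfolding L0_suminf_def by blast
    have "AE w in M. f n w = indicator (B n) w * ?g n w" for n
    proof -
      have "f n \<in> ?X z n" using f(1) by auto
      then show ?thesis unfolding X by (simp add: mem_cls eq_commute)
    qed
    then have "AE w in M. \<forall>n. f n w = indicator (B n) w * ?g n w" by (rule AE_all_nat)
    moreover have "AE w in M. (\<Sum>n. f n w) = ?h w" using f(2) by (simp add: mem_cls)
    ultimately show ?thesis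
    proof eventually_elim
      fix w assume w: "\<forall>n. f n w = indicator (B n) w * ?g n w" "(\<Sum>n. f n w) = ?h w"
      show "\<forall>n. w \<in> B n \<longrightarrow> ?h w = ?g n w"
        using w suminf_indicator_disjoint[OF dj, of w _ ?g] by simp
    qed
  qed
  with p show thesis by (rule that)
qed

text \<open>Concatenation along the partition with the single nonempty cell \<open>space M\<close>
  replaces a finite supremum by one member of \<open>P\<close>.\<close>

lemma sup_norm_mem:
  assumes c: "concat_seminorms M E P" and Q: "Q \<in> fin_subfamilies P"
  obtains p where "p \<in> P" "\<And>z. z \<in> carrier E \<Longrightarrow> AE w in M. nu p z w = L0_rep (sup_norm M Q z) w"
proof -
  let ?B = "\<lambda>n::nat. if n = 0 then space M else {}"
  have "countable_partition M ?B"
    by (auto simp: countable_partition_def disjoint_family_on_def)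
  then obtain p where p: "p \<in> P"
    "\<And>z. z \<in> carrier E \<Longrightarrow> AE w in M. \<forall>n. w \<in> ?B n \<longrightarrow> nu p z w = L0_rep (sup_norm M Q z) w"
    using concat_seminorms_mem[OF c, of ?B "\<lambda>_. Q"] Q by blast
  have "AE w in M. nu p z w = L0_rep (sup_norm M Q z) w" if "z \<in> carrier E" for z
    using p(2)[OF that] AE_space
  proof eventually_elim
    case (elim w)
    then show ?case using spec[OF elim(1), of 0] by simp
  qed
  with p(1) show thesis by (rule that)
qed

lemma openin_Tc:
  "openin (Tc M E P) U \<longleftrightarrow> U \<subseteq> carrier E \<and> (\<forall>x\<in>U. \<exists>Q\<in>fin_subfamilies P. \<exists>\<epsilon>\<in>L0_pplus M.
      {x \<oplus>\<^bsub>E\<^esub> y |y. y \<in> carrier E \<and> sup_norm M Q y \<sqsubseteq>\<^bsub>L0_ord M\<^esub> \<epsilon>} \<subseteq> U)"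
  unfolding Tc_def topology_inverse'[OF istopology_Tc[OF seminorms]] ..

text \<open>If \<open>P\<close> were empty there would be no balls, and the empty set would be the
  only open set.\<close>

lemma topspace_Tc:
  assumes "P \<noteq> {}"
  shows "topspace (Tc M E P) = carrier E"
proof
  show "topspace (Tc M E P) \<subseteq> carrier E" using openin_Tc[of "topspace (Tc M E P)"] by simp
  obtain p where "p \<in> P" using assms by blast
  then have "{p} \<in> fin_subfamilies P" by (simp add: fin_subfamilies_def)
  moreover have "cls M (\<lambda>_. 1) \<in> L0_pplus M" by (simp add: L0_pplus_cls)
  ultimately have "openin (Tc M E P) (carrier E)" unfolding openin_Tc by blast
  then show "carrier E \<subseteq> topspace (Tc M E P)" by (rule openin_subset)
qed

text \<open>A point of \<open>G\<close> lies in the open set \<open>topspace (Tc M E P)\<close>,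
  hence has a ball around it there, and the ball is given by a nonempty subfamily of
  \<open>P\<close>.\<close>

lemma seminorms_nonempty:
  assumes "closedin (Tc M E P) G" "G \<noteq> {}"
  shows "P \<noteq> {}"
proof -
  obtain y where "y \<in> topspace (Tc M E P)" using assms closedin_subset by blast
  then obtain Q where "Q \<in> fin_subfamilies P"
    using openin_topspace[of "Tc M E P"] unfolding openin_Tc by blast
  then show ?thesis by (auto simp: fin_subfamilies_def)
qed

lemma closedin_Tc_avoid:
  assumes G: "closedin (Tc M E P) G" "G \<noteq> {}" and x: "x \<in> carrier E" "x \<notin> G"
  obtains Q e where "Q \<in> fin_subfamilies P" "e \<in> borel_measurable M" "AE w in M. 0 < e w"
    "\<And>y. y \<in> carrier E \<Longrightarrow> (AE w in M. L0_rep (sup_norm M Q y) w \<le> e w) \<Longrightarrow> x \<oplus>\<^bsub>E\<^esub> y \<notin> G"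
proof -
  have "openin (Tc M E P) (carrier E - G)"
    using G topspace_Tc[OF seminorms_nonempty[OF G]] by (simp add: closedin_def)
  then obtain Q \<epsilon> where Q: "Q \<in> fin_subfamilies P" "\<epsilon> \<in> L0_pplus M"
    "{x \<oplus>\<^bsub>E\<^esub> y |y. y \<in> carrier E \<and> sup_norm M Q y \<sqsubseteq>\<^bsub>L0_ord M\<^esub> \<epsilon>} \<subseteq> carrier E - G"
    unfolding openin_Tc using x by blast
  obtain e where e: "e \<in> borel_measurable M" "\<epsilon> = cls M e"
    using Q(2) by (auto simp: L0_pplus_def L0_plus_def elim: L0_cases)
  show thesis
  proof (rule that[OF Q(1) e(1)])
    show "AE w in M. 0 < e w" using Q(2) e by (simp add: L0_pplus_cls)
    show "x \<oplus>\<^bsub>E\<^esub> y \<notin> G" if y: "y \<in> carrier E" and le: "AE w in M. L0_rep (sup_norm M Q y) w \<le> e w" for y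
    proof -
      have L: "sup_norm M Q y \<in> L0 M" using sup_norm_L0[OF Q(1) y] .
      have "cls M (L0_rep (sup_norm M Q y)) \<sqsubseteq>\<^bsub>L0_ord M\<^esub> cls M e"
        using le L0_rep_measurable[OF L] e by (simp add: le_cls)
      then have "sup_norm M Q y \<sqsubseteq>\<^bsub>L0_ord M\<^esub> \<epsilon>" by (simp add: cls_L0_rep[OF L] e)
      then show ?thesis using Q(3) y by blast
    qed
  qed
qed

section \<open>Gluing one seminorm and one margin of maximal support\<close>

lemma separating_seminorm:
  assumes conc: "concat_seminorms M E P" and x: "x \<in> carrier E"
    and G: "G \<subseteq> carrier E" "G \<noteq> {}" "closedin (Tc M E P) G" "L0_convex M E G" "concat_set M E G"
    and xG: "x \<notin> G"
  obtains p d where "p \<in> P" "d \<in> borel_measurable M" "\<And>w. 0 \<le> d w"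
    "\<And>y. y \<in> G \<Longrightarrow> AE w in M. d w \<le> nu p (x \<ominus>\<^bsub>E\<^esub> y) w"
    "AE w in M. w \<in> strat M E {x} G \<longrightarrow> 0 < d w"
    "\<not> (AE w in M. d w = 0)"
proof -
  have Gc: "y \<in> carrier E" if "y \<in> G" for y using G(1) that by blast
  have xc: "x \<ominus>\<^bsub>E\<^esub> y \<in> carrier E" if "y \<in> G" for y using x Gc[OF that] by simp
  \<comment> \<open>On \<open>B\<close> the seminorm \<open>p\<close> keeps \<open>x\<close> away
    from every point of \<open>G\<close> by the random margin \<open>e\<close>. The set
    \<open>U\<close> below is an essential supremum of all such \<open>B\<close>.\<close>
  define R where "R B p e \<longleftrightarrow> p \<in> P \<and> e \<in> borel_measurable M \<and> (\<forall>w\<in>B. 0 < e w) \<and>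
    (\<forall>y\<in>G. AE w in M. w \<in> B \<longrightarrow> e w \<le> nu p (x \<ominus>\<^bsub>E\<^esub> y) w)" for B p and e :: "'w \<Rightarrow> real"
  define \<A> where "\<A> = {B \<in> sets M. \<exists>p e. R B p e}"
  obtain p0 where p0: "p0 \<in> P" using seminorms_nonempty[OF G(3,2)] by blast
  \<comment> \<open>The empty set makes the family nonempty, so that a sequence of members can be
    extracted.\<close>
  have "R {} p0 (\<lambda>_. 0)" using p0 by (simp add: R_def)
  then have "\<A> \<subseteq> sets M" "\<A> \<noteq> {}" unfolding \<A>_def by blast+
  then obtain A :: "nat \<Rightarrow> 'w set" where A: "range A \<subseteq> \<A>"
    "\<And>B. B \<in> \<A> \<Longrightarrow> AE w in M. w \<in> B \<longrightarrow> w \<in> (\<Union>n. A n)"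
    by (rule ess_sup_sets_countable) blast
  then have "A n \<in> \<A>" for n by blast
  then have As: "A n \<in> sets M" and "\<exists>p e. R (A n) p e" for n unfolding \<A>_def by auto
  then obtain p e where "\<And>n. R (A n) (p n) (e n)" by metis
  then have p: "p n \<in> P" and e: "e n \<in> borel_measurable M" and epos: "w \<in> A n \<Longrightarrow> 0 < e n w"
    and ele: "y \<in> G \<Longrightarrow> AE w in M. w \<in> A n \<longrightarrow> e n w \<le> nu (p n) (x \<ominus>\<^bsub>E\<^esub> y) w" for n w y
    unfolding R_def by blast+
  define U where "U = (\<Union>n. A n)"
  have Us: "U \<in> sets M" using As by (auto simp: U_def)
  obtain B where B: "countable_partition M B" "\<And>n. B n \<inter> (\<Union>n. A n) \<subseteq> A n"
    using exists_countable_partition[of A M, OF As] by blast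
  have Bs: "B n \<in> sets M" and dj: "disjoint_family B" and BU: "(\<Union>n. B n) = space M" for n
    using B(1) by (auto simp: countable_partition_def)
  \<comment> \<open>On \<open>U\<close> the margin of the current cell is used. The factor
    \<open>indicator U\<close> removes the part of the cells outside \<open>U\<close>, where the
    witnesses say nothing.\<close>
  define d where "d w = indicator U w * (\<Sum>n. indicator (B n) w * e n w)" for w
  have d_eq: "d w = e n w \<and> w \<in> A n" if "w \<in> U" "w \<in> B n" for w n
    using that suminf_indicator_disjoint[OF dj that(2), of e] B(2)[of n] by (auto simp: d_def U_def)
  have U_B: "\<exists>n. w \<in> B n" if "w \<in> U" for w
    using sets.sets_into_space[OF Us] that BU by blast
  have dpos: "0 < d w" if w: "w \<in> U" for w
    using U_B[OF w] d_eq[OF w] epos by force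
  have dzero: "d w = 0" if "w \<notin> U" for w using that by (simp add: d_def)
  have dm: "d \<in> borel_measurable M"
    unfolding d_def[abs_def] using Us Bs e by (intro borel_measurable_times borel_measurable_suminf) auto
  have "{p n} \<in> fin_subfamilies P" for n using p by (simp add: fin_subfamilies_def)
  then obtain q where q: "q \<in> P"
    "\<And>z. z \<in> carrier E \<Longrightarrow> AE w in M. \<forall>n. w \<in> B n \<longrightarrow> nu q z w = L0_rep (sup_norm M {p n} z) w"
    using concat_seminorms_mem[OF conc B(1), of "\<lambda>n. {p n}"] by blast
  have dle: "AE w in M. d w \<le> nu q (x \<ominus>\<^bsub>E\<^esub> y) w" if y: "y \<in> G" for y
  proof -
    have "AE w in M. \<forall>n. w \<in> A n \<longrightarrow> e n w \<le> nu (p n) (x \<ominus>\<^bsub>E\<^esub> y) w"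
      using ele[OF y] by (rule AE_all_nat)
    with q(2)[OF xc[OF y]] nu_nonneg[OF q(1) xc[OF y]] show ?thesis
    proof eventually_elim
      case (elim w)
      show ?case
      proof (cases "w \<in> U")
        case True
        then obtain n where n: "w \<in> B n" using U_B by blast
        then show ?thesis
          using elim d_eq[OF True n] sup_norm_singleton[OF p xc[OF y]] by (auto simp: nu_def)
      qed (use elim dzero in simp)
    qed
  qed
  define V where "V = space M - U"
  have Vs: "V \<in> sets M" using Us by (simp add: V_def)
  define I where "I = (indicator V :: 'w \<Rightarrow> real)"
  have I [measurable]: "I \<in> borel_measurable M" using Vs by (simp add: I_def)
  have I01: "0 \<le> I w" "I w \<le> 1" for w by (simp_all add: I_def indicator_def)
  obtain y0 where y0: "y0 \<in> G" using G(2) by blast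
  \<comment> \<open>This vector is \<open>x\<close> on \<open>V\<close> and \<open>y0\<close> on
    \<open>U\<close>. That it belongs to \<open>G\<close> is the central claim, from which both
    remaining conclusions about \<open>d\<close> follow.\<close>
  define x' where "x' = rsc I x \<oplus>\<^bsub>E\<^esub> rsc (\<lambda>w. 1 - I w) y0"
  have x'c: "x' \<in> carrier E" using x Gc[OF y0] by (simp add: x'_def)
  have x'G: "x' \<in> G"
  proof (rule ccontr)
    assume "x' \<notin> G"
    then obtain Q e' where Q: "Q \<in> fin_subfamilies P" and e': "e' \<in> borel_measurable M" "AE w in M. 0 < e' w"
      and avoid: "\<And>y. y \<in> carrier E \<Longrightarrow> (AE w in M. L0_rep (sup_norm M Q y) w \<le> e' w) \<Longrightarrow> x' \<oplus>\<^bsub>E\<^esub> y \<notin> G"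
      using closedin_Tc_avoid[OF G(3,2) x'c] by blast
    obtain p' where p': "p' \<in> P" "\<And>z. z \<in> carrier E \<Longrightarrow> AE w in M. nu p' z w = L0_rep (sup_norm M Q z) w"
      using sup_norm_mem[OF conc Q] by blast
    \<comment> \<open>The set on which \<open>y\<close> comes within \<open>e'\<close> of
      \<open>x\<close>. Countably many of these sets cover each of them up to a null set.\<close>
    define C where "C y = {w \<in> space M. nu p' (x \<ominus>\<^bsub>E\<^esub> y) w \<le> e' w}" for y
    have Cs: "C y \<in> sets M" if "y \<in> G" for y
      unfolding C_def using nu_measurable[OF p'(1) xc[OF that]] e'(1) by measurable
    have "C ` G \<subseteq> sets M" "C ` G \<noteq> {}" using Cs G(2) by auto
    then obtain F :: "nat \<Rightarrow> 'w set" where F: "range F \<subseteq> C ` G"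
      "\<And>B. B \<in> C ` G \<Longrightarrow> AE w in M. w \<in> B \<longrightarrow> w \<in> (\<Union>n. F n)"
      by (rule ess_sup_sets_countable) blast
    have "\<exists>y. y \<in> G \<and> F n = C y" for n using F(1) by blast
    then obtain y where y: "\<And>n. y n \<in> G" "\<And>n. F n = C (y n)" by metis
    have Fs: "F n \<in> sets M" for n using y Cs by simp
    \<comment> \<open>The part of \<open>V\<close> that no point of \<open>G\<close> approaches
      within \<open>e'\<close>. It belongs to \<open>\<A>\<close>, so it lies in \<open>U\<close> up
      to a null set; being disjoint from \<open>U\<close>, it is null. The condition
      \<open>0 < e' w\<close> is imposed since \<open>e'\<close> is positive only almost everywhere,
      while \<open>R\<close> asks for positivity at every point.\<close>
    define D where "D = {w \<in> space M. w \<in> V \<and> w \<notin> (\<Union>n. F n) \<and> 0 < e' w}"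
    have "AE w in M. w \<in> D \<longrightarrow> e' w \<le> nu p' (x \<ominus>\<^bsub>E\<^esub> z) w" if z: "z \<in> G" for z
      using F(2)[OF imageI[OF z]] by eventually_elim (auto simp: D_def C_def)
    then have "R D p' e'" using p'(1) e'(1) by (simp add: R_def) (simp add: D_def)
    moreover have "D \<in> sets M" unfolding D_def using Vs Fs e'(1) by measurable
    ultimately have "D \<in> \<A>" by (auto simp: \<A>_def)
    from A(2)[OF this] e'(2) AE_space have VF: "AE w in M. w \<in> V \<longrightarrow> w \<in> (\<Union>n. F n)"
      by eventually_elim (auto simp: D_def V_def U_def)
    obtain B' where B': "countable_partition M B'" "\<And>n. B' n \<inter> (\<Union>n. F n) \<subseteq> F n"
      using exists_countable_partition[of F M, OF Fs] by blast
    have B's: "B' n \<in> sets M" and B'U: "(\<Union>n. B' n) = space M" for n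
      using B'(1) by (auto simp: countable_partition_def)
    \<comment> \<open>The approximating points \<open>y n\<close> are glued into a single
      \<open>z\<close> in \<open>G\<close> that is within \<open>e'\<close> of \<open>x\<close>
      almost everywhere on \<open>V\<close>.\<close>
    obtain z where z: "z \<in> G"
      "\<And>n. L0_indicator M (B' n) \<odot>\<^bsub>E\<^esub> z = L0_indicator M (B' n) \<odot>\<^bsub>E\<^esub> y n"
      using G(5)[unfolded concat_set_def, rule_format, of B' y] B'(1) y(1) by blast
    have "AE w in M. w \<in> B' n \<longrightarrow> nu p' (x \<ominus>\<^bsub>E\<^esub> z) w = nu p' (x \<ominus>\<^bsub>E\<^esub> y n) w" for n
    proof (rule nu_local[OF p'(1) B's xc[OF z(1)] xc[OF y(1)]])
      show "rsc (indicator (B' n)) (x \<ominus>\<^bsub>E\<^esub> z) = rsc (indicator (B' n)) (x \<ominus>\<^bsub>E\<^esub> y n)"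
        using z(2)[of n] x Gc[OF z(1)] Gc[OF y(1)] B's by (simp add: rsc_sub L0_indicator_smult)
    qed
    then have "AE w in M. \<forall>n. w \<in> B' n \<longrightarrow> nu p' (x \<ominus>\<^bsub>E\<^esub> z) w = nu p' (x \<ominus>\<^bsub>E\<^esub> y n) w"
      by (rule AE_all_nat)
    with VF have zle: "AE w in M. w \<in> V \<longrightarrow> nu p' (x \<ominus>\<^bsub>E\<^esub> z) w \<le> e' w"
      using AE_space
    proof eventually_elim
      case (elim w)
      obtain n where n: "w \<in> B' n" using B'U elim(3) by blast
      have "w \<in> F n" if "w \<in> V" using that elim(1) n B'(2) by blast
      then show ?case using elim(2) n by (auto simp: y(2) C_def)
    qed
    \<comment> \<open>Adding \<open>v\<close> to \<open>x'\<close> replaces \<open>x\<close> by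
      \<open>z\<close> on \<open>V\<close> and changes nothing on \<open>U\<close>. Since
      \<open>v\<close> is small, \<open>x' + v\<close> must avoid \<open>G\<close>; yet it is a
      convex combination of \<open>z\<close> and \<open>y0\<close>.\<close>
    define v where "v = \<ominus>\<^bsub>E\<^esub> rsc I (x \<ominus>\<^bsub>E\<^esub> z)"
    have vc: "v \<in> carrier E" using xc[OF z(1)] by (simp add: v_def)
    have "v = rsc (\<lambda>w. - I w) (x \<ominus>\<^bsub>E\<^esub> z)" using xc[OF z(1)] by (simp add: v_def rsc_uminus)
    then have "AE w in M. nu p' v w = \<bar>I w\<bar> * nu p' (x \<ominus>\<^bsub>E\<^esub> z) w"
      using nu_rsc[OF p'(1), of "\<lambda>w. - I w" "x \<ominus>\<^bsub>E\<^esub> z"] xc[OF z(1)] by simp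
    with zle e'(2) p'(2)[OF vc] have "AE w in M. L0_rep (sup_norm M Q v) w \<le> e' w"
    proof eventually_elim
      case (elim w)
      then show ?case by (cases "w \<in> V") (simp_all add: I_def)
    qed
    then have "x' \<oplus>\<^bsub>E\<^esub> v \<notin> G" by (rule avoid[OF vc])
    moreover have "x' \<oplus>\<^bsub>E\<^esub> v = rsc I z \<oplus>\<^bsub>E\<^esub> rsc (\<lambda>w. 1 - I w) y0"
    proof -
      let ?a = "rsc I x" and ?b = "rsc (\<lambda>w. 1 - I w) y0" and ?c = "rsc I z"
      have c: "?a \<in> carrier E" "?b \<in> carrier E" "?c \<in> carrier E"
        using x Gc[OF y0] Gc[OF z(1)] by auto
      have "v = \<ominus>\<^bsub>E\<^esub> ?a \<oplus>\<^bsub>E\<^esub> ?c"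
        using x Gc[OF z(1)] c by (simp add: v_def rsc_sub M.minus_add)
      then have "x' \<oplus>\<^bsub>E\<^esub> v = (?a \<oplus>\<^bsub>E\<^esub> \<ominus>\<^bsub>E\<^esub> ?a) \<oplus>\<^bsub>E\<^esub> (?c \<oplus>\<^bsub>E\<^esub> ?b)"
        using c unfolding x'_def by (simp add: M.a_ac)
      then show ?thesis using c by (simp add: M.r_neg)
    qed
    moreover have "rsc I z \<oplus>\<^bsub>E\<^esub> rsc (\<lambda>w. 1 - I w) y0 \<in> G"
      by (rule L0_convexD[OF G(4) z(1) y0 I I01])
    ultimately show False by simp
  qed
  show thesis
  proof (rule that[OF q(1) dm])
    show "0 \<le> d w" for w using dpos[of w] dzero[of w] by (cases "w \<in> U") auto
    show "AE w in M. d w \<le> nu q (x \<ominus>\<^bsub>E\<^esub> y) w" if "y \<in> G" for y using dle[OF that] .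
    let ?\<S> = "{A \<in> sets M. (\<odot>\<^bsub>E\<^esub>) (L0_indicator M A) ` {x} \<inter> (\<odot>\<^bsub>E\<^esub>) (L0_indicator M A) ` G \<noteq> {}}"
    \<comment> \<open>On \<open>V\<close> the point \<open>x\<close> agrees with \<open>x'\<close>
      in \<open>G\<close>, so \<open>V\<close> is one of the sets whose essential supremum is
      removed in \<open>strat\<close>. Thus the stratification lies in \<open>U\<close> up to a null
      set, where \<open>d\<close> is positive.\<close>
    have "(\<lambda>w. I w * I w) = I" "(\<lambda>w. I w * (1 - I w)) = (\<lambda>_. 0)"
      by (auto simp: I_def indicator_def fun_eq_iff)
    then have "rsc I x' = rsc I x"
      using x Gc[OF y0] unfolding x'_def by (simp add: rsc_add_right rsc_rsc)
    then have "rsc I x \<in> rsc I ` G" using x'G by (metis imageI)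
    then have "V \<in> ?\<S>" using Vs by (simp add: L0_indicator_smult I_def)
    moreover have "is_ess_sup_sets M ?\<S> (ess_sup_sets M ?\<S>)"
      by (rule ess_sup_sets_exists[OF prob_space_axioms]) blast
    ultimately have "AE w in M. w \<in> V \<longrightarrow> w \<in> ess_sup_sets M ?\<S>"
      by (simp only: is_ess_sup_sets_def)
    then show "AE w in M. w \<in> strat M E {x} G \<longrightarrow> 0 < d w"
      by eventually_elim (use dpos in \<open>auto simp: strat_def V_def\<close>)
    show "\<not> (AE w in M. d w = 0)"
    proof
      assume "AE w in M. d w = 0"
      \<comment> \<open>If \<open>d\<close> vanishes almost everywhere then \<open>U\<close> is
        null, so \<open>I\<close> is one almost everywhere. As scalars are classes, this gives the
        equality \<open>x' = x\<close>, contradicting \<open>x \<notin> G\<close>.\<close>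
      then have I1: "AE w in M. I w = 1" using AE_space
      proof eventually_elim
        case (elim w)
        then have "w \<notin> U" using dpos[of w] by auto
        then show ?case using elim by (simp add: I_def V_def)
      qed
      then have "AE w in M. 1 - I w = 0" by eventually_elim simp
      then have "rsc (\<lambda>w. 1 - I w) y0 = rsc (\<lambda>_. 0) y0" by (intro rsc_cong_AE) simp_all
      moreover have "rsc I x = rsc (\<lambda>_. 1) x" using I1 by (intro rsc_cong_AE) simp_all
      ultimately have "x' = x" using x Gc[OF y0] by (simp add: x'_def)
      then show False using x'G xG by simp
    qed
  qed
qed

end

section \<open>Continuity of bounded module homomorphisms\<close>

text \<open>This makes the description of open sets and of the underlying space available for the
  codomain topology \<open>Tc_L0 M\<close> as well.\<close>

lemma L0_seminormed_module_L0_alg: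
  assumes "prob_space M"
  shows "L0_seminormed_module M
    (L0_alg M :: (('w \<Rightarrow> 'k::{real_normed_field, second_countable_topology}) set, ('w \<Rightarrow> 'k) set) module)
    {\<lambda>\<xi>\<in>L0 M. lift1 M norm \<xi>}"
proof -
  interpret prob_space M by fact
  let ?L = "L0 M :: ('w \<Rightarrow> 'k) set set"
  have norm: "lift1 M norm (cls M f) = cls M (\<lambda>w. norm (f w))"
    if "f \<in> borel_measurable M" for f :: "'w \<Rightarrow> 'k" using that by (intro lift1_cls) auto
  have "L0_seminorm M (L0_alg M :: (('w \<Rightarrow> 'k) set, ('w \<Rightarrow> 'k) set) module) (\<lambda>\<xi>\<in>?L. lift1 M norm \<xi>)"
    unfolding L0_seminorm_def
  proof (intro conjI ballI)
    have "lift1 M norm \<xi> \<in> L0_plus M" if "\<xi> \<in> ?L" for \<xi>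
      using that by (elim L0_cases) (simp add: norm L0_plus_cls)
    then show "(\<lambda>\<xi>\<in>?L. lift1 M norm \<xi>) \<in> carrier (L0_alg M) \<rightarrow>\<^sub>E L0_plus M"
      by (auto simp: L0_alg_def)
    fix x y :: "('w \<Rightarrow> 'k) set" assume "x \<in> carrier (L0_alg M)" "y \<in> carrier (L0_alg M)"
    then have "x \<in> ?L" "y \<in> ?L" by (simp_all add: L0_alg_def)
    then obtain f g where fg: "f \<in> borel_measurable M" "x = cls M f" "g \<in> borel_measurable M" "y = cls M g"
      by (elim L0_cases)
    show "(\<lambda>\<xi>\<in>?L. lift1 M norm \<xi>) (x \<oplus>\<^bsub>L0_alg M\<^esub> y) \<sqsubseteq>\<^bsub>L0_ord M\<^esub>
      (\<lambda>\<xi>\<in>?L. lift1 M norm \<xi>) x \<oplus>\<^bsub>L0_alg M\<^esub> (\<lambda>\<xi>\<in>?L. lift1 M norm \<xi>) y"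
      using fg by (simp add: L0_alg_simps norm le_cls norm_triangle_ineq)
  next
    fix \<xi> x :: "('w \<Rightarrow> 'k) set" assume "\<xi> \<in> ?L" "x \<in> carrier (L0_alg M)"
    then have "\<xi> \<in> ?L" "x \<in> ?L" by (simp_all add: L0_alg_def)
    then obtain f g where fg: "f \<in> borel_measurable M" "\<xi> = cls M f" "g \<in> borel_measurable M" "x = cls M g"
      by (elim L0_cases)
    then show "(\<lambda>\<xi>\<in>?L. lift1 M norm \<xi>) (\<xi> \<odot>\<^bsub>L0_alg M\<^esub> x) =
      lift1 M norm \<xi> \<otimes>\<^bsub>L0_alg M\<^esub> (\<lambda>\<xi>\<in>?L. lift1 M norm \<xi>) x"
      by (simp add: L0_alg_simps norm norm_mult)
  qed
  then show ?thesis
    by (intro L0_seminormed_module.intro L0_module.intro L0_seminormed_module_axioms.intro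
        prob_space_axioms module_L0_alg) simp
qed

text \<open>By additivity and the bound, the ball of radius \<open>e / C\<close> for
  \<open>p\<close> around \<open>x\<close> is mapped into the ball of radius \<open>e\<close> around
  \<open>f x\<close>, so preimages of open sets are open.\<close>

lemma (in L0_seminormed_module) dual_cI:
  assumes f: "f \<in> carrier E \<rightarrow>\<^sub>E L0 M"
    and add: "\<And>x y. x \<in> carrier E \<Longrightarrow> y \<in> carrier E \<Longrightarrow> f (x \<oplus>\<^bsub>E\<^esub> y) = f x \<oplus>\<^bsub>L0_alg M\<^esub> f y"
    and hom: "\<And>\<xi> x. \<xi> \<in> L0 M \<Longrightarrow> x \<in> carrier E \<Longrightarrow> f (\<xi> \<odot>\<^bsub>E\<^esub> x) = \<xi> \<otimes>\<^bsub>L0_alg M\<^esub> f x"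
    and p: "p \<in> P" and C: "0 < C"
    and bound: "\<And>x. x \<in> carrier E \<Longrightarrow> AE w in M. norm (L0_rep (f x) w) \<le> C * nu p x w"
  shows "f \<in> dual_c M E P"
proof -
  let ?n = "\<lambda>\<xi>\<in>(L0 M :: ('w \<Rightarrow> 'k) set set). lift1 M norm \<xi>"
  interpret L: L0_seminormed_module M "L0_alg M :: (('w \<Rightarrow> 'k) set, ('w \<Rightarrow> 'k) set) module" "{?n}"
    by (rule L0_seminormed_module_L0_alg[OF prob_space_axioms])
  have fL: "f x \<in> L0 M" if "x \<in> carrier E" for x using f that by auto
  have "P \<noteq> {}" using p by blast
  then have ts: "topspace (Tc M E P) = carrier E" by (rule topspace_Tc)
  have "openin (Tc M E P) {x \<in> carrier E. f x \<in> U}" if U: "openin (Tc_L0 M) U" for U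
    unfolding openin_Tc
  proof (intro conjI ballI)
    fix x assume "x \<in> {x \<in> carrier E. f x \<in> U}"
    then have x: "x \<in> carrier E" "f x \<in> U" by auto
    obtain Q \<epsilon> where Q: "Q \<in> fin_subfamilies {?n}" "\<epsilon> \<in> L0_pplus M"
      "{f x \<oplus>\<^bsub>L0_alg M\<^esub> y |y. y \<in> carrier (L0_alg M) \<and> sup_norm M Q y \<sqsubseteq>\<^bsub>L0_ord M\<^esub> \<epsilon>} \<subseteq> U"
      using U x(2) unfolding Tc_L0_def L.openin_Tc by blast
    have Qn: "Q = {?n}" using Q(1) by (auto simp: fin_subfamilies_def)
    obtain e where e: "e \<in> borel_measurable M" "\<epsilon> = cls M e"
      using Q(2) by (auto simp: L0_pplus_def L0_plus_def elim: L0_cases)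
    have epos: "AE w in M. 0 < e w" using Q(2) e by (simp add: L0_pplus_cls)
    have em: "(\<lambda>w. e w / C) \<in> borel_measurable M" using e(1) by simp
    have pQ: "{p} \<in> fin_subfamilies P" using p by (simp add: fin_subfamilies_def)
    have "AE w in M. 0 < e w / C" using epos by eventually_elim (simp add: C)
    then have "cls M (\<lambda>w. e w / C) \<in> L0_pplus M" using em by (simp add: L0_pplus_cls)
    moreover have "f (x \<oplus>\<^bsub>E\<^esub> y) \<in> U"
      if y: "y \<in> carrier E" and le: "sup_norm M {p} y \<sqsubseteq>\<^bsub>L0_ord M\<^esub> cls M (\<lambda>w. e w / C)" for y
    proof -
      note fm = L0_rep_measurable[OF fL[OF y]]
      have "cls M (nu p y) \<sqsubseteq>\<^bsub>L0_ord M\<^esub> cls M (\<lambda>w. e w / C)"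
        using le by (simp add: sup_norm_singleton[OF p y] cls_nu[OF p y])
      then have "AE w in M. nu p y w \<le> e w / C"
        using em nu_measurable[OF p y] by (simp add: le_cls)
      with bound[OF y] have "AE w in M. norm (L0_rep (f y) w) \<le> e w"
      proof eventually_elim
        case (elim w)
        have "C * nu p y w \<le> C * (e w / C)" using elim(2) C by (intro mult_left_mono) auto
        then show ?case using elim(1) C by simp
      qed
      then have "cls M (\<lambda>w. norm (L0_rep (f y) w)) \<sqsubseteq>\<^bsub>L0_ord M\<^esub> \<epsilon>"
        using fm e by (simp add: le_cls)
      moreover have "lift1 M norm (cls M (L0_rep (f y))) = cls M (\<lambda>w. norm (L0_rep (f y) w))"
        using fm by (intro lift1_cls) auto
      then have "sup_norm M Q (f y) = cls M (\<lambda>w. norm (L0_rep (f y) w))"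
        using L.sup_norm_singleton[of ?n "f y"] fL[OF y] by (simp add: Qn cls_L0_rep)
      ultimately have "sup_norm M Q (f y) \<sqsubseteq>\<^bsub>L0_ord M\<^esub> \<epsilon>" by simp
      then have "f x \<oplus>\<^bsub>L0_alg M\<^esub> f y \<in> U"
        using fL[OF y] by (intro subsetD[OF Q(3)] CollectI exI[of _ "f y"]) simp
      then show ?thesis using add[OF x(1) y] by simp
    qed
    ultimately show "\<exists>Q\<in>fin_subfamilies P. \<exists>\<epsilon>\<in>L0_pplus M.
        {x \<oplus>\<^bsub>E\<^esub> y |y. y \<in> carrier E \<and> sup_norm M Q y \<sqsubseteq>\<^bsub>L0_ord M\<^esub> \<epsilon>} \<subseteq> {x \<in> carrier E. f x \<in> U}"
      using pQ x(1) by (intro bexI[of _ "{p}"] bexI[of _ "cls M (\<lambda>w. e w / C)"]) auto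
  qed blast
  moreover have "f \<in> topspace (Tc M E P) \<rightarrow> topspace (Tc_L0 M)"
    using fL unfolding ts Tc_L0_def by (subst L.topspace_Tc) auto
  ultimately have "continuous_map (Tc M E P) (Tc_L0 M) f"
    unfolding continuous_map_def ts by blast
  then show ?thesis using f add hom by (simp add: dual_c_def)
qed

section \<open>From a margin to strict inequalities with the supremum\<close>

text \<open>The margin \<open>d\<close> is independent of \<open>y\<close>, so
  \<open>r x - d\<close> is an upper bound of all values on \<open>G\<close> and hence of their
  supremum. As \<open>r x\<close> is finite, this is strict where \<open>d\<close> is positive, and
  equality with \<open>r x\<close> would force \<open>d = 0\<close> almost everywhere. The map
  \<open>g\<close> stands for the functional itself or for its real part.\<close>

lemma (in prob_space) sup_separation:
  assumes d: "d \<in> borel_measurable M" "\<And>w. 0 \<le> d w" "AE w in M. w \<in> H \<longrightarrow> 0 < d w" "\<not> (AE w in M. d w = 0)"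
    and r: "r x \<in> borel_measurable M" "\<And>y. y \<in> G \<Longrightarrow> r y \<in> borel_measurable M"
    and le: "\<And>y. y \<in> G \<Longrightarrow> AE w in M. r y w + d w \<le> r x w"
    and g: "g x = cls M (r x)" "\<And>y. y \<in> G \<Longrightarrow> g y = cls M (r y)"
  shows "gt_on M H (L0_ereal M (g x)) (\<Squnion>\<^bsub>L0_ord M\<^esub> {L0_ereal M (g y) |y. y \<in> G}) \<and>
    (\<Squnion>\<^bsub>L0_ord M\<^esub> {L0_ereal M (g y) |y. y \<in> G}) \<sqsubset>\<^bsub>L0_ord M\<^esub> L0_ereal M (g x)"
proof -
  let ?S = "{L0_ereal M (g y) |y. y \<in> G}"
  have er: "L0_ereal M (cls M f) = cls M (\<lambda>w. ereal (f w))" if "f \<in> borel_measurable M" for f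
    using that by (intro lift1_cls) auto
  have "L0_ereal M (g y) = cls M (\<lambda>w. ereal (r y w))" if "y \<in> G" for y
    using er[OF r(2)[OF that]] g(2)[OF that] by simp
  then have S: "?S = {cls M (\<lambda>w. ereal (r y w)) |y. y \<in> G}"
    by (intro Collect_cong ex_cong1) auto
  have rx: "(\<lambda>w. ereal (r x w)) \<in> borel_measurable M" "(\<lambda>w. ereal (r x w - d w)) \<in> borel_measurable M"
    using r(1) d(1) by auto
  have ry: "(\<lambda>w. ereal (r y w)) \<in> borel_measurable M" if "y \<in> G" for y using r(2)[OF that] by simp
  have SL: "?S \<subseteq> L0 M" unfolding S using ry by auto
  have lub: "least (L0_ord M) (\<Squnion>\<^bsub>L0_ord M\<^esub> ?S) (Upper (L0_ord M) ?S)"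
    by (rule L0_ord_sup_ereal[OF SL])
  then have "\<Squnion>\<^bsub>L0_ord M\<^esub> ?S \<in> L0 M" by (auto simp: least_def Upper_def)
  then obtain h where h: "h \<in> borel_measurable M" "\<Squnion>\<^bsub>L0_ord M\<^esub> ?S = cls M h" by (rule L0_cases)
  have "cls M (\<lambda>w. ereal (r y w)) \<sqsubseteq>\<^bsub>L0_ord M\<^esub> cls M (\<lambda>w. ereal (r x w - d w))" if y: "y \<in> G" for y
  proof -
    have "AE w in M. ereal (r y w) \<le> ereal (r x w - d w)"
      using le[OF y] by eventually_elim (simp add: algebra_simps)
    then show ?thesis using le_cls[OF ry[OF y] rx(2)] by blast
  qed
  then have "cls M (\<lambda>w. ereal (r x w - d w)) \<in> Upper (L0_ord M) ?S"
    using rx(2) unfolding S Upper_def by auto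
  then have "cls M h \<sqsubseteq>\<^bsub>L0_ord M\<^esub> cls M (\<lambda>w. ereal (r x w - d w))"
    using lub unfolding h(2) least_def by blast
  then have hle: "AE w in M. h w \<le> ereal (r x w - d w)" using h rx(2) by (simp add: le_cls)
  have gx: "L0_ereal M (g x) = cls M (\<lambda>w. ereal (r x w))" using er[OF r(1)] g(1) by simp
  show ?thesis unfolding h(2) gx
  proof
    have "AE w in M. w \<in> H \<longrightarrow> h w < ereal (r x w)"
      using hle d(3)
    proof eventually_elim
      case (elim w)
      show ?case
      proof
        assume "w \<in> H"
        then have "ereal (r x w - d w) < ereal (r x w)" using elim(2) by simp
        with elim(1) show "h w < ereal (r x w)" by (rule le_less_trans)
      qed
    qed
    then show "gt_on M H (cls M (\<lambda>w. ereal (r x w))) (cls M h)"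
      unfolding gt_on_def using h(1) rx(1)
      by (intro bexI[of _ "\<lambda>w. ereal (r x w)"] bexI[of _ h]) (auto simp: mem_cls)
    have "AE w in M. h w \<le> ereal (r x w)"
      using hle
    proof eventually_elim
      case (elim w)
      have "ereal (r x w - d w) \<le> ereal (r x w)" using d(2)[of w] by simp
      with elim show ?case by (rule order_trans)
    qed
    then have "cls M h \<sqsubseteq>\<^bsub>L0_ord M\<^esub> cls M (\<lambda>w. ereal (r x w))"
      using h(1) rx(1) by (simp add: le_cls)
    moreover have "cls M h \<noteq> cls M (\<lambda>w. ereal (r x w))"
    proof
      assume "cls M h = cls M (\<lambda>w. ereal (r x w))"
      then have "AE w in M. h w = ereal (r x w)" using h(1) rx(1) by (simp add: cls_eq_iff)
      with hle have "AE w in M. d w = 0"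
      proof eventually_elim
        case (elim w)
        then show ?case using d(2)[of w] by simp
      qed
      then show False using d(4) by blast
    qed
    ultimately show "cls M h \<sqsubset>\<^bsub>L0_ord M\<^esub> cls M (\<lambda>w. ereal (r x w))"
      by (simp add: lless_def L0_ord_def)
  qed
qed

section \<open>The real and the complex separation theorem\<close>

lemma real_separation:
  fixes E :: "(('w \<Rightarrow> real) set, 'a) module"
  assumes lc: "random_lc_module M E P" and conc: "concat_seminorms M E P" and x: "x \<in> carrier E"
    and G: "G \<subseteq> carrier E" "G \<noteq> {}" "closedin (Tc M E P) G" "L0_convex M E G" "concat_set M E G"
    and xG: "x \<notin> G"
  shows "\<exists>f\<in>dual_c M E P.
    gt_on M (strat M E {x} G) (L0_ereal M (f x)) (\<Squnion>\<^bsub>L0_ord M\<^esub> {L0_ereal M (f y) |y. y \<in> G}) \<and>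
    (\<Squnion>\<^bsub>L0_ord M\<^esub> {L0_ereal M (f y) |y. y \<in> G}) \<sqsubset>\<^bsub>L0_ord M\<^esub> L0_ereal M (f x)"
proof -
  interpret L0_seminormed_module M E P
    using lc by (simp add: random_lc_module_def L0_seminormed_module_def L0_module_def
        L0_seminormed_module_axioms_def)
  obtain p d where p: "p \<in> P" and d: "d \<in> borel_measurable M" "\<And>w. 0 \<le> d w"
    "\<And>y. y \<in> G \<Longrightarrow> AE w in M. d w \<le> nu p (x \<ominus>\<^bsub>E\<^esub> y) w"
    "AE w in M. w \<in> strat M E {x} G \<longrightarrow> 0 < d w" "\<not> (AE w in M. d w = 0)"
    using separating_seminorm[OF conc x G xG] by blast
  obtain r where r: "\<And>z. z \<in> carrier E \<Longrightarrow> r z \<in> borel_measurable M"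
    and add: "\<And>y z. y \<in> carrier E \<Longrightarrow> z \<in> carrier E \<Longrightarrow> AE w in M. r (y \<oplus>\<^bsub>E\<^esub> z) w = r y w + r z w"
    and hom: "\<And>\<xi> z. \<xi> \<in> borel_measurable M \<Longrightarrow> z \<in> carrier E \<Longrightarrow> AE w in M. r (rsc \<xi> z) w = \<xi> w * r z w"
    and bound: "\<And>z. z \<in> carrier E \<Longrightarrow> AE w in M. \<bar>r z w\<bar> \<le> nu p z w"
    and sep: "\<And>y. y \<in> G \<Longrightarrow> AE w in M. r y w + d w \<le> r x w"
    using separating_functional[OF p d(1) x G(4,2) d(3)] by blast
  define f where "f = (\<lambda>z\<in>carrier E. cls M (r z))"
  have f: "f z = cls M (r z)" if "z \<in> carrier E" for z using that by (simp add: f_def)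
  have "f \<in> dual_c M E P"
  proof (rule dual_cI[OF _ _ _ p, of _ 1])
    show "f \<in> carrier E \<rightarrow>\<^sub>E L0 M" using r by (simp add: f_def)
    show "f (y \<oplus>\<^bsub>E\<^esub> z) = f y \<oplus>\<^bsub>L0_alg M\<^esub> f z" if yz: "y \<in> carrier E" "z \<in> carrier E" for y z
      using add[OF yz] r yz r[OF M.a_closed[OF yz]] by (simp add: f L0_alg_simps cls_eq_iff)
    show "f (\<xi> \<odot>\<^bsub>E\<^esub> z) = \<xi> \<otimes>\<^bsub>L0_alg M\<^esub> f z" if \<xi>: "\<xi> \<in> L0 M" and z: "z \<in> carrier E" for \<xi> z
    proof -
      obtain a where a: "a \<in> borel_measurable M" "\<xi> = cls M a" using \<xi> by (rule L0_cases)
      \<comment> \<open>Over the reals \<open>of_real\<close> is the identity, so \<open>rsc\<close>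
        is the whole scalar multiplication.\<close>
      have eq: "\<xi> \<odot>\<^bsub>E\<^esub> z = rsc a z" by (simp add: rsc_def a(2))
      show ?thesis
        using hom[OF a(1) z] r[OF z] r[OF rsc_closed[OF a(1) z]] a(1) z
        unfolding eq by (simp add: f L0_alg_simps cls_eq_iff a(2))
    qed
    show "AE w in M. norm (L0_rep (f z) w) \<le> 1 * nu p z w" if z: "z \<in> carrier E" for z
      using AE_L0_rep_cls[OF r[OF z]] bound[OF z] unfolding f[OF z] by eventually_elim simp
  qed simp
  moreover have "gt_on M (strat M E {x} G) (L0_ereal M (f x)) (\<Squnion>\<^bsub>L0_ord M\<^esub> {L0_ereal M (f y) |y. y \<in> G}) \<and>
    (\<Squnion>\<^bsub>L0_ord M\<^esub> {L0_ereal M (f y) |y. y \<in> G}) \<sqsubset>\<^bsub>L0_ord M\<^esub> L0_ereal M (f x)"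
    by (rule sup_separation[where d = d and r = r and g = f]) (use d r sep f x G(1) in auto)
  ultimately show ?thesis by blast
qed

lemma complex_separation:
  fixes E :: "(('w \<Rightarrow> complex) set, 'a) module"
  assumes lc: "random_lc_module M E P" and conc: "concat_seminorms M E P" and x: "x \<in> carrier E"
    and G: "G \<subseteq> carrier E" "G \<noteq> {}" "closedin (Tc M E P) G" "L0_convex M E G" "concat_set M E G"
    and xG: "x \<notin> G"
  shows "\<exists>f\<in>dual_c M E P.
    gt_on M (strat M E {x} G) (L0_ereal M (lift1 M Re (f x)))
      (\<Squnion>\<^bsub>L0_ord M\<^esub> {L0_ereal M (lift1 M Re (f y)) |y. y \<in> G}) \<and>
    (\<Squnion>\<^bsub>L0_ord M\<^esub> {L0_ereal M (lift1 M Re (f y)) |y. y \<in> G}) \<sqsubset>\<^bsub>L0_ord M\<^esub> L0_ereal M (lift1 M Re (f x))"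
proof -
  interpret L0_seminormed_module M E P
    using lc by (simp add: random_lc_module_def L0_seminormed_module_def L0_module_def
        L0_seminormed_module_axioms_def)
  obtain p d where p: "p \<in> P" and d: "d \<in> borel_measurable M" "\<And>w. 0 \<le> d w"
    "\<And>y. y \<in> G \<Longrightarrow> AE w in M. d w \<le> nu p (x \<ominus>\<^bsub>E\<^esub> y) w"
    "AE w in M. w \<in> strat M E {x} G \<longrightarrow> 0 < d w" "\<not> (AE w in M. d w = 0)"
    using separating_seminorm[OF conc x G xG] by blast
  obtain r where r: "\<And>z. z \<in> carrier E \<Longrightarrow> r z \<in> borel_measurable M"
    and add: "\<And>y z. y \<in> carrier E \<Longrightarrow> z \<in> carrier E \<Longrightarrow> AE w in M. r (y \<oplus>\<^bsub>E\<^esub> z) w = r y w + r z w"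
    and hom: "\<And>\<xi> z. \<xi> \<in> borel_measurable M \<Longrightarrow> z \<in> carrier E \<Longrightarrow> AE w in M. r (rsc \<xi> z) w = \<xi> w * r z w"
    and bound: "\<And>z. z \<in> carrier E \<Longrightarrow> AE w in M. \<bar>r z w\<bar> \<le> nu p z w"
    and sep: "\<And>y. y \<in> G \<Longrightarrow> AE w in M. r y w + d w \<le> r x w"
    using separating_functional[OF p d(1) x G(4,2) d(3)] by blast
  let ?i = "cls M (\<lambda>_. \<i>)"
  define J where "J z = ?i \<odot>\<^bsub>E\<^esub> z" for z
  have iL: "?i \<in> carrier (L0_alg M)" by simp
  have J: "J z \<in> carrier E" if "z \<in> carrier E" for z
    unfolding J_def using iL that by (rule smult_closed)
  have J_add: "J (y \<oplus>\<^bsub>E\<^esub> z) = J y \<oplus>\<^bsub>E\<^esub> J z" if "y \<in> carrier E" "z \<in> carrier E" for y z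
    unfolding J_def using iL that by (rule smult_r_distr)
  have J_nu: "AE w in M. nu p (J z) w = nu p z w" if z: "z \<in> carrier E" for z
    using nu_smult[OF p _ z, of "\<lambda>_. \<i>"] by (simp add: J_def)
  \<comment> \<open>The imaginary part is forced: a complex linear functional \<open>f\<close> with
    real part \<open>r\<close> satisfies
    \<open>Im (f z) = - Re (\<i> f z) = - r (\<i> z)\<close>.\<close>
  define F where "F z w = Complex (r z w) (- r (J z) w)" for z w
  have F: "F z \<in> borel_measurable M" if z: "z \<in> carrier E" for z
  proof -
    have "F z = (\<lambda>w. of_real (r z w) - \<i> * of_real (r (J z) w))"
      by (simp add: fun_eq_iff F_def complex_eq_iff)
    then show ?thesis using r[OF z] r[OF J[OF z]] by simp
  qed
  define f where "f = (\<lambda>z\<in>carrier E. cls M (F z))"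
  have f: "f z = cls M (F z)" if "z \<in> carrier E" for z using that by (simp add: f_def)
  have "f \<in> dual_c M E P"
  \<comment> \<open>The constant 2 comes from bounding the modulus by
    \<open>\<bar>r z\<bar> + \<bar>r (J z)\<bar>\<close>, where \<open>J z\<close> has the same
    seminorm as \<open>z\<close>.\<close>
  proof (rule dual_cI[OF _ _ _ p, of _ 2])
    show "f \<in> carrier E \<rightarrow>\<^sub>E L0 M" using F by (simp add: f_def)
    show "f (y \<oplus>\<^bsub>E\<^esub> z) = f y \<oplus>\<^bsub>L0_alg M\<^esub> f z" if yz: "y \<in> carrier E" "z \<in> carrier E" for y z
    proof -
      have "AE w in M. F (y \<oplus>\<^bsub>E\<^esub> z) w = F y w + F z w"
        using add[OF yz] add[OF J[OF yz(1)] J[OF yz(2)]]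
        unfolding F_def J_add[OF yz] by eventually_elim (simp add: complex_eq_iff)
      then show ?thesis
        using F yz F[OF M.a_closed[OF yz]] by (simp add: f L0_alg_simps cls_eq_iff)
    qed
    show "f (\<xi> \<odot>\<^bsub>E\<^esub> z) = \<xi> \<otimes>\<^bsub>L0_alg M\<^esub> f z" if \<xi>: "\<xi> \<in> L0 M" and z: "z \<in> carrier E" for \<xi> z
    proof -
      obtain c where c: "c \<in> borel_measurable M" "\<xi> = cls M c" using \<xi> by (rule L0_cases)
      have \<xi>z: "\<xi> \<odot>\<^bsub>E\<^esub> z \<in> carrier E" using \<xi> z by (intro smult_closed) simp_all
      let ?a = "\<lambda>w. Re (c w)" and ?b = "\<lambda>w. Im (c w)"
      have m [measurable]: "?a \<in> borel_measurable M" "?b \<in> borel_measurable M" using c(1) by measurable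
      have smult: "cls M g \<odot>\<^bsub>E\<^esub> (cls M h \<odot>\<^bsub>E\<^esub> z) = cls M (\<lambda>w. g w * h w) \<odot>\<^bsub>E\<^esub> z"
        if "g \<in> borel_measurable M" "h \<in> borel_measurable M" for g h
        using smult_assoc1[of "cls M g" "cls M h" z] that z by (simp add: L0_alg_simps)
      have split: "rsc g z \<oplus>\<^bsub>E\<^esub> rsc h (J z) = cls M (\<lambda>w. of_real (g w) + of_real (h w) * \<i>) \<odot>\<^bsub>E\<^esub> z"
        if g: "g \<in> borel_measurable M" and h: "h \<in> borel_measurable M" for g h
      proof -
        have "rsc h (J z) = cls M (\<lambda>w. of_real (h w) * \<i>) \<odot>\<^bsub>E\<^esub> z"
          unfolding rsc_def J_def using h by (intro smult) simp_all
        moreover have "(\<lambda>w. complex_of_real (h w) * \<i>) \<in> borel_measurable M" using h by simp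
        ultimately show ?thesis
          using smult_l_distr[of "cls M (\<lambda>w. of_real (g w))" "cls M (\<lambda>w. of_real (h w) * \<i>)" z] g z
          by (simp add: rsc_def L0_alg_simps)
      qed
      \<comment> \<open>Writing \<open>c = a + b \<i>\<close> and
        \<open>\<i> c = - b + a \<i>\<close> reduces complex multipliers to real ones acting on
        \<open>z\<close> and \<open>J z\<close>, to which the homogeneity of \<open>r\<close>
        applies.\<close>
      have e1: "\<xi> \<odot>\<^bsub>E\<^esub> z = rsc ?a z \<oplus>\<^bsub>E\<^esub> rsc ?b (J z)"
        unfolding split[OF m] c(2) by (simp add: complex_eq[symmetric] mult.commute[of _ \<i>])
      have e2: "J (\<xi> \<odot>\<^bsub>E\<^esub> z) = rsc (\<lambda>w. - ?b w) z \<oplus>\<^bsub>E\<^esub> rsc ?a (J z)"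
      proof -
        have "(\<lambda>w. \<i> * c w) = (\<lambda>w. of_real (- ?b w) + of_real (?a w) * \<i>)"
          by (simp add: fun_eq_iff complex_eq_iff)
        then have "J (\<xi> \<odot>\<^bsub>E\<^esub> z) = cls M (\<lambda>w. of_real (- ?b w) + of_real (?a w) * \<i>) \<odot>\<^bsub>E\<^esub> z"
          unfolding J_def c(2) using c(1) by (subst smult) simp_all
        then show ?thesis by (subst split) simp_all
      qed
      note Jz = J[OF z] and mb = borel_measurable_uminus[OF m(2)]
      have "AE w in M. r (\<xi> \<odot>\<^bsub>E\<^esub> z) w = r (rsc ?a z) w + r (rsc ?b (J z)) w"
        unfolding e1 using m z Jz by (intro add) simp_all
      moreover have "AE w in M. r (J (\<xi> \<odot>\<^bsub>E\<^esub> z)) w = r (rsc (\<lambda>w. - ?b w) z) w + r (rsc ?a (J z)) w"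
        unfolding e2 using m mb z Jz by (intro add) simp_all
      moreover note hom[OF m(1) z] hom[OF m(2) Jz] hom[OF mb z] hom[OF m(1) Jz]
      ultimately have "AE w in M. F (\<xi> \<odot>\<^bsub>E\<^esub> z) w = c w * F z w"
        by eventually_elim (simp add: F_def complex_eq_iff)
      then show ?thesis
        using F[OF z] F[OF \<xi>z] c(1) by (simp add: f[OF z] f[OF \<xi>z] c(2)[symmetric])
          (simp add: c(2) L0_alg_simps cls_eq_iff)
    qed
    show "AE w in M. norm (L0_rep (f z) w) \<le> 2 * nu p z w" if z: "z \<in> carrier E" for z
      using AE_L0_rep_cls[OF F[OF z]] bound[OF z] bound[OF J[OF z]] J_nu[OF z] unfolding f[OF z]
    proof eventually_elim
      case (elim w)
      have "norm (F z w) \<le> \<bar>r z w\<bar> + \<bar>r (J z) w\<bar>"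
        using cmod_le[of "F z w"] by (simp add: F_def)
      then show ?case using elim by simp
    qed
  qed simp
  moreover have "lift1 M Re (f z) = cls M (r z)" if z: "z \<in> carrier E" for z
    using lift1_cls[OF F[OF z], of Re] by (simp add: f[OF z] F_def)
  then have "gt_on M (strat M E {x} G) (L0_ereal M (lift1 M Re (f x)))
      (\<Squnion>\<^bsub>L0_ord M\<^esub> {L0_ereal M (lift1 M Re (f y)) |y. y \<in> G}) \<and>
    (\<Squnion>\<^bsub>L0_ord M\<^esub> {L0_ereal M (lift1 M Re (f y)) |y. y \<in> G}) \<sqsubset>\<^bsub>L0_ord M\<^esub> L0_ereal M (lift1 M Re (f x))"
    by (intro sup_separation[where d = d and r = r and g = "\<lambda>z. lift1 M Re (f z)"])
      (use d r sep x G(1) in auto)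
  ultimately show ?thesis by blast
qed

theorem theorem3p23:
  fixes M :: "'w measure"
  assumes "prob_space M"
  shows
    "(\<forall>(E :: (('w \<Rightarrow> real) set, 'a) module) P x G.
        random_lc_module M E P \<and> concat_seminorms M E P \<and> x \<in> carrier E \<and>
        G \<subseteq> carrier E \<and> G \<noteq> {} \<and> closedin (Tc M E P) G \<and> L0_convex M E G \<and>
        x \<notin> G \<and> concat_set M E G \<longrightarrow>
        (\<exists>f\<in>dual_c M E P.
          gt_on M (strat M E {x} G) (L0_ereal M (f x)) (\<Squnion>\<^bsub>L0_ord M\<^esub> {L0_ereal M (f y) |y. y \<in> G}) \<and>
          (\<Squnion>\<^bsub>L0_ord M\<^esub> {L0_ereal M (f y) |y. y \<in> G}) \<sqsubset>\<^bsub>L0_ord M\<^esub> L0_ereal M (f x))) \<and>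
     (\<forall>(E :: (('w \<Rightarrow> complex) set, 'b) module) P x G.
        random_lc_module M E P \<and> concat_seminorms M E P \<and> x \<in> carrier E \<and>
        G \<subseteq> carrier E \<and> G \<noteq> {} \<and> closedin (Tc M E P) G \<and> L0_convex M E G \<and>
        x \<notin> G \<and> concat_set M E G \<longrightarrow>
        (\<exists>f\<in>dual_c M E P.
          gt_on M (strat M E {x} G) (L0_ereal M (lift1 M Re (f x)))
            (\<Squnion>\<^bsub>L0_ord M\<^esub> {L0_ereal M (lift1 M Re (f y)) |y. y \<in> G}) \<and>
          (\<Squnion>\<^bsub>L0_ord M\<^esub> {L0_ereal M (lift1 M Re (f y)) |y. y \<in> G})
            \<sqsubset>\<^bsub>L0_ord M\<^esub> L0_ereal M (lift1 M Re (f x))))"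
  by (intro conjI allI impI; elim conjE) (rule real_separation complex_separation; assumption)+

end
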